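(* For $(G,\rho)=(\mathrm{GL}(n),\mathrm{Std})$, $n\ge1$, set $\lambda_i:=\varepsilon_{n-i+1}+\cdots+\varepsilon_n$ for $1\le i\le n$. Then $$\sum_{\mu\in X_*(T)_\ominus}c_\mu(q^{-1})e^\mu X^{\det(\mu)}=\prod_{i=1}^n\left(1-q^{\frac{i(i-1)}{2}}e^{\lambda_i}X^i\right)^{-1}$$ as formal power series.
   Context: $T$ is the diagonal torus and $B$ the upper triangular Borel subgroup of $G=\mathrm{GL}(n)$; $\varepsilon_1,\dots,\varepsilon_n$ is the standard basis of $X_*(T)$; $\det:X_*(T)\to\mathbb{Z}$, $\sum a_i\varepsilon_i\mapsto\sum a_i$. $W=\mathfrak{S}_n$ with length $\ell$. $\Sigma_B$ (resp. $\Delta_B$) denotes positive (resp. simple) roots. $X_*(T)_-=\{\sum a_i\varepsilon_i:a_1\le\cdots\le a_n\}$ and $X_*(T)_\ominus=\{\mu\in X_*(T)_-:\det(\mu)\ge0\}$. $\check\rho_{B^-}$ is the half-sum of negative coroots. $\mu\le\lambda$ iff $\lambda-\mu$ is a $\mathbb{Z}_{\ge0}$-combination of $-\alpha^\vee$, $\alpha\in\Delta_B$. The dual group is $\hat G=\mathrm{GL}(n,\mathbb{C})$ with $X^*(\hat T)=X_*(T)$, and $\mathrm{Std}$ is its standard representation on $\mathbb{C}^n$; for $\lambda\in X_*(T)_-$, $V(\lambda)$ is the irreducible representation of $\hat G$ with highest weight $\lambda$ relative to the opposite Borel $\hat B^-$. Define $\mathcal{P}(\nu;q)$ by $\prod_{\alpha\in\Sigma_B}(1-qe^{-\alpha^\vee})^{-1}=\sum_\nu\mathcal{P}(\nu;q)e^\nu$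 and $K_{\lambda,\mu}(q)=\sum_{w\in W}(-1)^{\ell(w)}\mathcal{P}(w(\lambda+\check\rho_{B^-})-(\mu+\check\rho_{B^-});q)$. For $\mu\in X_*(T)_\ominus$, $c_\mu(q)=\sum_{\lambda\in X_*(T)_-,\lambda\ge\mu}K_{\lambda,\mu}(q^{-1})\,\mathrm{mult}(\mathrm{Sym}^{\det\mu}(\mathrm{Std}):V(\lambda))$, where $\mathrm{mult}$ is the multiplicity. The symbols $e^\mu$ satisfy $e^{\mu+\mu'}=e^\mu e^{\mu'}$. *)

theory Defs
  imports
    "HOL-Library.Poly_Mapping"
    "HOL-Library.Function_Algebras"
    "HOL-Computational_Algebra.Formal_Power_Series"
    "HOL-Computational_Algebra.Polynomial"
    "HOL-Combinatorics.Permutations"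
    "HOL-Analysis.Infinite_Sum"
    "Jordan_Normal_Form.Matrix"
begin

section \<open>Cocharacters of the diagonal torus\<close>

text \<open>The cocharacter \<open>\<Sum> a\<^sub>i \<epsilon>\<^sub>i\<close> of the diagonal torus of \<open>GL(n)\<close> is the function
  \<open>a\<close>, supported on \<open>{1..n}\<close>; addition is pointwise.\<close>

type_synonym cochar = "nat \<Rightarrow> int"

definition cochars :: "nat \<Rightarrow> cochar set" where
  "cochars n = {\<mu>. \<forall>i. i \<notin> {1..n} \<longrightarrow> \<mu> i = 0}"

definition eps :: "nat \<Rightarrow> cochar" where
  "eps i = (\<lambda>j. if j = i then 1 else 0)"

definition cochar_det :: "nat \<Rightarrow> cochar \<Rightarrow> int" where
  "cochar_det n \<mu> = (\<Sum>i=1..n. \<mu> i)"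

definition cochars_minus :: "nat \<Rightarrow> cochar set" where
  "cochars_minus n = {\<mu> \<in> cochars n. \<forall>i j. 1 \<le> i \<and> i \<le> j \<and> j \<le> n \<longrightarrow> \<mu> i \<le> \<mu> j}"

definition cochars_ominus :: "nat \<Rightarrow> cochar set" where
  "cochars_ominus n = {\<mu> \<in> cochars_minus n. cochar_det n \<mu> \<ge> 0}"

text \<open>The root \<open>t \<mapsto> t\<^sub>i / t\<^sub>j\<close> is represented by the pair \<open>(i, j)\<close>.\<close>

definition positive_roots :: "nat \<Rightarrow> (nat \<times> nat) set" where
  "positive_roots n = {(i, j). 1 \<le> i \<and> i < j \<and> j \<le> n}"

definition simple_roots :: "nat \<Rightarrow> (nat \<times> nat) set" where
  "simple_roots n = {(i, j). 1 \<le> i \<and> j = Suc i \<and> j \<le> n}"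

definition coroot :: "nat \<times> nat \<Rightarrow> cochar" where
  "coroot \<alpha> = eps (fst \<alpha>) - eps (snd \<alpha>)"

definition cochar_le :: "nat \<Rightarrow> cochar \<Rightarrow> cochar \<Rightarrow> bool" where
  "cochar_le n \<mu> lam \<longleftrightarrow>
     (\<exists>k :: nat \<times> nat \<Rightarrow> nat. \<forall>i. lam i - \<mu> i = (\<Sum>\<alpha>\<in>simple_roots n. int (k \<alpha>) * (- coroot \<alpha> i)))"

definition rho_neg :: "nat \<Rightarrow> nat \<Rightarrow> rat" where
  "rho_neg n i = (\<Sum>\<alpha>\<in>positive_roots n. of_int (- coroot \<alpha> i)) / 2"


section \<open>The Weyl group\<close>

text \<open>Coxeter length on the symmetric group of \<open>{1..n}\<close>: the least number of factors in an
  expression as a product of simple reflections.\<close>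

definition weyl_length :: "nat \<Rightarrow> (nat \<Rightarrow> nat) \<Rightarrow> nat" where
  "weyl_length n w = (LEAST k. \<exists>is. length is = k \<and> set is \<subseteq> {1..<n} \<and>
     w = foldr (\<lambda>i. (\<circ>) (Transposition.transpose i (Suc i))) is id)"

text \<open>\<open>w \<epsilon>\<^sub>i = \<epsilon>\<^bsub>w i\<^esub>\<close>, also on cocharacters with rational coefficients.\<close>

definition weyl_act :: "(nat \<Rightarrow> nat) \<Rightarrow> (nat \<Rightarrow> 'a) \<Rightarrow> nat \<Rightarrow> 'a" where
  "weyl_act w lam = lam \<circ> inv_into UNIV w"


section \<open>The \<open>q\<close>-analogue of Kostant's partition function\<close>

text \<open>\<open>e\<^sup>\<nu>\<close> in the group algebra of the cocharacter group with coefficients in \<open>'a\<close>.\<close>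

definition expo :: "cochar \<Rightarrow> cochar \<Rightarrow>\<^sub>0 'a::comm_ring_1" where
  "expo \<nu> = Poly_Mapping.single \<nu> 1"

text \<open>In \<open>kostant_series\<close> the power series variable \<open>fps_X\<close> plays the role of \<open>q\<close>.  Over a
  commutative ring, \<open>fps_right_inverse f 1\<close> is the inverse of a series \<open>f\<close> with constant
  term 1.\<close>

definition kostant_series :: "nat \<Rightarrow> (cochar \<Rightarrow>\<^sub>0 int) fps" where
  "kostant_series n =
     (\<Prod>\<alpha>\<in>positive_roots n. fps_right_inverse (1 - fps_X * fps_const (expo (- coroot \<alpha>))) 1)"

definition kostant_P :: "nat \<Rightarrow> cochar \<Rightarrow> int poly" where
  "kostant_P n \<nu> = Abs_poly (\<lambda>k. Poly_Mapping.lookup (fps_nth (kostant_series n) k) \<nu>)"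

text \<open>The exponents \<open>w(\<lambda> + \<rho>) - (\<mu> + \<rho>)\<close> are integral although \<open>\<rho>\<close> is only half-integral, so the
  floor only converts the type.\<close>

definition kostka_K :: "nat \<Rightarrow> cochar \<Rightarrow> cochar \<Rightarrow> int poly" where
  "kostka_K n lam \<mu> = (\<Sum>w | w permutes {1..n}. (-1) ^ weyl_length n w *
     kostant_P n (\<lambda>i. \<lfloor>weyl_act w (\<lambda>j. of_int (lam j) + rho_neg n j) i - (of_int (\<mu> i) + rho_neg n i)\<rfloor>))"

text \<open>The coefficients defining \<open>kostant_P\<close> do vanish in large degrees, because the degree in
  \<open>q\<close> is bounded by the linear form \<open>\<Sum> i \<nu>\<^sub>i\<close>, which is at least 1 on negative coroots.\<close>

lemma fps_right_inverse_one_minus: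
  fixes c :: "'a::comm_ring_1"
  shows "fps_right_inverse (1 - fps_X * fps_const c) 1 = Abs_fps (\<lambda>k. c ^ k)"
proof -
  let ?f = "1 - fps_X * fps_const c :: 'a fps"
  let ?g = "Abs_fps (\<lambda>k. c ^ k)"
  let ?h = "fps_right_inverse ?f 1"
  have g: "?g * ?f = 1"
  proof (rule fps_ext)
    fix k
    have "?g * ?f = ?g - fps_X * (fps_const c * ?g)" by (simp add: algebra_simps)
    then show "fps_nth (?g * ?f) k = fps_nth 1 k"
      by (cases k) auto
  qed
  have "?f * ?h = 1" by (rule fps_right_inverse) simp
  then have "?g = ?g * (?f * ?h)" by simp
  also have "\<dots> = ?h" by (simp only: mult.assoc[symmetric] g mult_1_left)
  finally show ?thesis by simp
qed

lemma coeff_kostant_P: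
  "coeff (kostant_P n \<nu>) k = Poly_Mapping.lookup (fps_nth (kostant_series n) k) \<nu>"
proof -
  define h :: "cochar \<Rightarrow> int" where "h = (\<lambda>\<nu>. \<Sum>i=1..n. int i * \<nu> i)"
  define S :: "(cochar \<Rightarrow>\<^sub>0 int) fps \<Rightarrow> bool"
    where "S = (\<lambda>A. \<forall>k. \<forall>\<nu>\<in>Poly_Mapping.keys (fps_nth A k). int k \<le> h \<nu>)"
  have h_add: "h (a + b) = h a + h b" for a b
    by (simp add: h_def algebra_simps sum.distrib)
  have h_0: "h 0 = 0" by (simp add: h_def)
  have S_1: "S 1"
    by (auto simp: S_def h_0 fps_one_nth)
  have S_mult: "S (A * B)" if "S A" "S B" for A B
    unfolding S_def
  proof (intro allI ballI)
    fix k \<nu>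
    assume "\<nu> \<in> Poly_Mapping.keys (fps_nth (A * B) k)"
    then have "\<nu> \<in> (\<Union>i\<in>{0..k}. Poly_Mapping.keys (fps_nth A i * fps_nth B (k - i)))"
      unfolding fps_mult_nth using keys_sum[of "\<lambda>i. fps_nth A i * fps_nth B (k - i)"] by blast
    then obtain i where i: "i \<le> k"
      and \<nu>: "\<nu> \<in> Poly_Mapping.keys (fps_nth A i * fps_nth B (k - i))" by auto
    then obtain a b where ab: "\<nu> = a + b" "a \<in> Poly_Mapping.keys (fps_nth A i)"
      "b \<in> Poly_Mapping.keys (fps_nth B (k - i))"
      using keys_mult by blast
    then have "int i \<le> h a" "int (k - i) \<le> h b" using that unfolding S_def by blast+
    then show "int k \<le> h \<nu>" using i unfolding ab(1) h_add by linarith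
  qed
  have h_root: "1 \<le> h (- coroot \<alpha>)" if \<alpha>: "\<alpha> \<in> positive_roots n" for \<alpha>
  proof -
    obtain i j where ij: "\<alpha> = (i, j)" "1 \<le> i" "i < j" "j \<le> n"
      using \<alpha> by (auto simp: positive_roots_def)
    have h_eps: "h (eps i) = int i" if "i \<in> {1..n}" for i
      using that by (simp add: h_def eps_def if_distrib[of "(*) (int _)"] sum.delta cong: if_cong)
    have "- coroot \<alpha> + eps i = eps j" by (simp add: coroot_def ij)
    then have "h (- coroot \<alpha>) + h (eps i) = h (eps j)" by (simp only: h_add[symmetric])
    then show ?thesis using ij by (simp add: h_eps)
  qed
  have S_factor: "S (fps_right_inverse (1 - fps_X * fps_const (expo (- coroot \<alpha>))) 1)"
    if "\<alpha> \<in> positive_roots n" for \<alpha>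
  proof -
    have "\<forall>\<nu>\<in>Poly_Mapping.keys ((expo (- coroot \<alpha>) :: cochar \<Rightarrow>\<^sub>0 int) ^ k). int k \<le> h \<nu>" for k
    proof (induction k)
      case (Suc k)
      show ?case
      proof
        fix \<nu>
        assume "\<nu> \<in> Poly_Mapping.keys ((expo (- coroot \<alpha>) :: cochar \<Rightarrow>\<^sub>0 int) ^ Suc k)"
        then obtain a b where ab: "\<nu> = a + b" "a \<in> Poly_Mapping.keys (expo (- coroot \<alpha>) :: cochar \<Rightarrow>\<^sub>0 int)"
          "b \<in> Poly_Mapping.keys ((expo (- coroot \<alpha>) :: cochar \<Rightarrow>\<^sub>0 int) ^ k)"
          unfolding power_Suc using keys_mult by blast
        have "a = - coroot \<alpha>" using ab(2) by (simp add: expo_def)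
        then have "1 \<le> h a" using h_root[OF that] by simp
        moreover have "int k \<le> h b" using Suc ab(3) by blast
        ultimately show "int (Suc k) \<le> h \<nu>" unfolding ab(1) h_add by simp
      qed
    qed (simp add: h_def)
    then show ?thesis by (simp add: S_def fps_right_inverse_one_minus)
  qed
  have "S (prod (\<lambda>\<alpha>. fps_right_inverse (1 - fps_X * fps_const (expo (- coroot \<alpha>))) 1) A)"
    if "A \<subseteq> positive_roots n" for A
    using that by (induction A rule: infinite_finite_induct) (auto simp del: One_nat_def intro!: S_1 S_mult S_factor)
  then have S: "S (kostant_series n)" by (simp add: kostant_series_def)
  have "Poly_Mapping.lookup (fps_nth (kostant_series n) k) \<nu> = 0" if "k > nat (h \<nu>)" for k
    using S that unfolding S_def by (force simp: in_keys_iff)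
  then show ?thesis unfolding kostant_P_def by (subst coeff_Abs_poly) auto
qed


section \<open>Representations of the dual group\<close>

definition GL :: "nat \<Rightarrow> complex mat set" where
  "GL n = {g \<in> carrier_mat n n. invertible_mat g}"

definition borel_minus :: "nat \<Rightarrow> complex mat set" where
  "borel_minus n = {g \<in> GL n. \<forall>i<n. \<forall>j<n. i < j \<longrightarrow> g $$ (i, j) = 0}"

text \<open>The character of \<open>borel_minus n\<close> attached to \<open>\<lambda>\<close>, viewed as a character of
  the dual torus of diagonal matrices and extended trivially to the unipotent radical.  Matrix indices start at 0.\<close>

definition borel_character :: "nat \<Rightarrow> cochar \<Rightarrow> complex mat \<Rightarrow> complex" where
  "borel_character n lam b = (\<Prod>i=1..n. b $$ (i - 1, i - 1) powi lam i)"

text \<open>Below, \<open>smul\<close> and \<open>act\<close> are the scalar multiplication and the group action on an ambient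
  representation, and \<open>U\<close>, \<open>W\<close> are subspaces of it.\<close>

definition subrep :: "nat \<Rightarrow> (complex \<Rightarrow> 'v::ab_group_add \<Rightarrow> 'v) \<Rightarrow> (complex mat \<Rightarrow> 'v \<Rightarrow> 'v) \<Rightarrow> 'v set \<Rightarrow> bool"
  where "subrep n smul act W \<longleftrightarrow> module.subspace smul W \<and> (\<forall>g\<in>GL n. \<forall>v\<in>W. act g v \<in> W)"

definition irreducible_rep ::
  "nat \<Rightarrow> (complex \<Rightarrow> 'v::ab_group_add \<Rightarrow> 'v) \<Rightarrow> (complex mat \<Rightarrow> 'v \<Rightarrow> 'v) \<Rightarrow> 'v set \<Rightarrow> bool"
  where "irreducible_rep n smul act W \<longleftrightarrow> subrep n smul act W \<and> W \<noteq> {0} \<and>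
    (\<forall>W'. subrep n smul act W' \<and> W' \<subseteq> W \<longrightarrow> W' = {0} \<or> W' = W)"

text \<open>\<open>W\<close> is a copy of \<open>V(\<lambda>)\<close>, i.e. an irreducible representation with highest weight \<open>\<lambda>\<close>
  relative to the opposite Borel subgroup; this determines a finite-dimensional rational
  representation up to isomorphism.\<close>

definition is_V ::
  "nat \<Rightarrow> (complex \<Rightarrow> 'v::ab_group_add \<Rightarrow> 'v) \<Rightarrow> (complex mat \<Rightarrow> 'v \<Rightarrow> 'v) \<Rightarrow> cochar \<Rightarrow> 'v set \<Rightarrow> bool"
  where "is_V n smul act lam W \<longleftrightarrow> irreducible_rep n smul act W \<and>
    (\<exists>v\<in>W. v \<noteq> 0 \<and> (\<forall>b\<in>borel_minus n. act b v = smul (borel_character n lam b) v))"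

text \<open>\<open>U\<close> is the internal direct sum of the irreducible subrepresentations in \<open>D\<close>.\<close>

definition irreducible_decomposition ::
  "nat \<Rightarrow> (complex \<Rightarrow> 'v::ab_group_add \<Rightarrow> 'v) \<Rightarrow> (complex mat \<Rightarrow> 'v \<Rightarrow> 'v) \<Rightarrow> 'v set \<Rightarrow> 'v set set \<Rightarrow> bool"
  where "irreducible_decomposition n smul act U D \<longleftrightarrow>
    finite D \<and> (\<forall>W\<in>D. irreducible_rep n smul act W) \<and>
    bij_betw (\<lambda>f. \<Sum>W\<in>D. f W) (\<Pi>\<^sub>E W\<in>D. W) U"

text \<open>The multiplicity of \<open>V(\<lambda>)\<close> in \<open>U\<close>: the number of summands isomorphic to \<open>V(\<lambda>)\<close>, which is
  the same in every decomposition into irreducibles.\<close>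

definition mult_V ::
  "nat \<Rightarrow> (complex \<Rightarrow> 'v::ab_group_add \<Rightarrow> 'v) \<Rightarrow> (complex mat \<Rightarrow> 'v \<Rightarrow> 'v) \<Rightarrow> 'v set \<Rightarrow> cochar \<Rightarrow> nat"
  where "mult_V n smul act U lam = (THE m. \<exists>D. irreducible_decomposition n smul act U D \<and>
    m = card {W \<in> D. is_V n smul act lam W})"


section \<open>Symmetric powers of the standard representation\<close>

text \<open>The symmetric algebra of \<open>\<complex>\<^sup>n\<close> is the polynomial ring in the standard basis vectors
  \<open>e\<^sub>1, \<dots>, e\<^sub>n\<close>; an element of \<open>nat \<Rightarrow>\<^sub>0 nat\<close> is a monomial.\<close>

type_synonym sym_alg = "(nat \<Rightarrow>\<^sub>0 nat) \<Rightarrow>\<^sub>0 complex"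

definition sym_scale :: "complex \<Rightarrow> sym_alg \<Rightarrow> sym_alg" where
  "sym_scale c = Poly_Mapping.map ((*) c)"

definition basis_vec :: "nat \<Rightarrow> sym_alg" where
  "basis_vec i = Poly_Mapping.single (Poly_Mapping.single i 1) 1"

definition sym_power :: "nat \<Rightarrow> nat \<Rightarrow> sym_alg set" where
  "sym_power n d = {p. \<forall>m\<in>Poly_Mapping.keys p. Poly_Mapping.keys m \<subseteq> {1..n} \<and>
     (\<Sum>i=1..n. Poly_Mapping.lookup m i) = d}"

definition std_act :: "nat \<Rightarrow> complex mat \<Rightarrow> nat \<Rightarrow> sym_alg" where
  "std_act n g j = (\<Sum>i=1..n. sym_scale (g $$ (i - 1, j - 1)) (basis_vec i))"

text \<open>\<open>g\<close> acts by the algebra endomorphism extending \<open>e\<^sub>j \<mapsto> g e\<^sub>j\<close>.\<close>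

definition sym_act :: "nat \<Rightarrow> complex mat \<Rightarrow> sym_alg \<Rightarrow> sym_alg" where
  "sym_act n g p = (\<Sum>m\<in>Poly_Mapping.keys p. sym_scale (Poly_Mapping.lookup p m)
     (\<Prod>j\<in>Poly_Mapping.keys m. std_act n g j ^ Poly_Mapping.lookup m j))"

definition mult_Sym :: "nat \<Rightarrow> nat \<Rightarrow> cochar \<Rightarrow> nat" where
  "mult_Sym n d lam = mult_V n sym_scale (sym_act n) (sym_power n d) lam"


section \<open>The coefficients \<open>c\<^sub>\<mu>\<close>\<close>

text \<open>Laurent polynomials in \<open>q\<close> over the integers: the group algebra of the integers.\<close>

type_synonym laurent = "int \<Rightarrow>\<^sub>0 int"

definition qpow :: "int \<Rightarrow> laurent" where
  "qpow k = Poly_Mapping.single k 1"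

definition invert_q :: "laurent \<Rightarrow> laurent" where
  "invert_q = Poly_Mapping.map_key uminus"

text \<open>\<open>c\<^sub>\<mu>(q)\<close>.  Infinitely many \<open>\<lambda>\<close> may satisfy \<open>\<lambda> \<ge> \<mu>\<close>, but only finitely many \<open>V(\<lambda>)\<close> occur in the
  symmetric power, and the sum is restricted to these.\<close>

definition c_coeff :: "nat \<Rightarrow> cochar \<Rightarrow> laurent" where
  "c_coeff n \<mu> = (\<Sum>lam | lam \<in> cochars_minus n \<and> cochar_le n \<mu> lam \<and> mult_Sym n (nat (cochar_det n \<mu>)) lam \<noteq> 0.
     poly (map_poly of_int (kostka_K n lam \<mu>)) (qpow (-1)) * of_nat (mult_Sym n (nat (cochar_det n \<mu>)) lam))"

definition fund_cochar :: "nat \<Rightarrow> nat \<Rightarrow> cochar" where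
  "fund_cochar n i = (\<Sum>j=n-i+1..n. eps j)"

end

(* Sym^d is irreducible: elements of the torus isolate monomials, and unitriangular elements lead from
   any monomial to e_n^d and from there to all monomials. Its highest weight is d eps_n, so c_mu reduces to
   K_{d eps_n, mu}(q^-1), and it remains to show K_{d eps_n, mu}(q) = q^{sum (n - i) mu_i} when all
   mu_i >= 0; otherwise d eps_n >= mu fails and c_mu = 0.

   In the defining sum of K_{d eps_n, mu} only the w fixing n contribute. Splitting off the roots involving n
   gives q^{mu_1 + ... + mu_{n-1}} times the sum of K_{a, mu'} over all compositions a of
   mu_1 + ... + mu_{n-1} into n - 1 parts, which straightens to the single term with a a multiple of
   eps_{n-1}; induction on n. The product formula then follows by writing mu = sum a_i lambda_i. *)
theory Submission
  imports Defs "Jordan_Normal_Form.Determinant" "HOL-Library.Nonpos_Ints"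
begin

section \<open>Length and sign\<close>

text \<open>Passing from n to n - 1 rests on coordinate n. Only the negative coroots eps_n - eps_i
  change it, each by 1, so for w fixing n the coordinate at n fixes how many of them occur, namely
  mu_1 + ... + mu_{n-1}, and this number is the power of q split off. Their distribution over i is
  free, so the compositions a occur in every order. Hence the alternating sum is studied at
  arbitrary arguments, where exchanging two entries changes its sign.

  The exponent n - i counts steps: mu_i contributes 1 each time one of the coordinates n, ..., i + 1
  is split off. For mu = lambda_i these exponents add up to 0 + 1 + ... + (i - 1), which explains
  i(i - 1)/2.

  For irreducibility the danger is cancellation when the image of a monomial is multiplied out.
  Triangular matrices with entries 0 and 1 keep all coefficients nonnegative, so no term can
  disappear.\<close>

definition word_perm :: "nat list \<Rightarrow> nat \<Rightarrow> nat" where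
  "word_perm xs = foldr (\<lambda>i. (\<circ>) (Transposition.transpose i (Suc i))) xs id"

lemma word_perm_simps [simp]:
  "word_perm [] = id"
  "word_perm (i # xs) = Transposition.transpose i (Suc i) \<circ> word_perm xs"
  by (simp_all only: word_perm_def foldr.simps o_apply id_apply)

lemma word_perm_append: "word_perm (xs @ ys) = word_perm xs \<circ> word_perm ys"
  by (induction xs) (simp_all add: o_assoc)

lemma sign_word_perm: "permutation (word_perm xs) \<and> sign (word_perm xs) = (-1) ^ length xs"
proof (induction xs)
  case (Cons i xs)
  then have xs: "permutation (word_perm xs)" "sign (word_perm xs) = (-1) ^ length xs" by auto
  show ?case
    unfolding word_perm_simps
    using permutation_compose[OF permutation_swap_id xs(1), of i "Suc i"]
      sign_compose[OF permutation_swap_id xs(1), of i "Suc i"]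
    by (simp only: sign_swap_id xs(2)) simp
qed simp

text \<open>Conjugating the transposition of a and b by the simple reflection of b and b + 1 gives
  the transposition of a and b + 1; hence the induction on b.\<close>

lemma transpose_is_word_perm:
  assumes "1 \<le> a" "a < b" "b \<le> n"
  shows "\<exists>is. set is \<subseteq> {1..<n} \<and> Transposition.transpose a b = word_perm is"
proof -
  have "Suc a \<le> b" using assms by simp
  then show ?thesis using assms(3)
  proof (induction b rule: dec_induct)
    case base
    then show ?case using assms(1) by (intro exI[of _ "[a]"]) auto
  next
    case (step b)
    then obtain xs where xs: "set xs \<subseteq> {1..<n}" "Transposition.transpose a b = word_perm xs"
      using step.prems by fastforce
    have "Transposition.transpose a (Suc b) = Transposition.transpose b (Suc b)
        \<circ> (Transposition.transpose a b \<circ> Transposition.transpose b (Suc b))"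
      using step.hyps by (auto simp: fun_eq_iff Transposition.transpose_def)
    also have "\<dots> = word_perm (b # xs @ [b])"
      by (simp add: word_perm_append xs o_assoc)
    finally show ?case using xs(1) step assms(1) by (intro exI[of _ "b # xs @ [b]"]) auto
  qed
qed

lemma permutes_is_word_perm:
  assumes "w permutes {1..n}"
  shows "\<exists>is. set is \<subseteq> {1..<n} \<and> w = word_perm is"
  using assms finite_atLeastAtMost
proof (induction rule: permutes_induct)
  case id
  show ?case by (intro exI[of _ "[]"]) auto
next
  case (swap a b p)
  have "\<exists>is. set is \<subseteq> {1..<n} \<and> Transposition.transpose a b = word_perm is"
  proof (cases "a < b")
    case True
    then show ?thesis using swap by (intro transpose_is_word_perm) auto
  next
    case False
    then show ?thesis using swap transpose_is_word_perm[of b a n]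
      by (simp add: transpose_commute)
  qed
  then obtain xs ys where "set xs \<subseteq> {1..<n}" "Transposition.transpose a b = word_perm xs"
    "set ys \<subseteq> {1..<n}" "p = word_perm ys"
    using swap.IH by blast
  then show ?case by (intro exI[of _ "xs @ ys"]) (auto simp: word_perm_append)
qed

text \<open>Each simple reflection has sign -1, so the sign of a product is determined by the length
  of any word for it. The existence of a word ensures that the LEAST in \<open>weyl_length\<close>
  is the length of an actual word.\<close>

lemma minus_one_power_weyl_length:
  assumes "w permutes {1..n}"
  shows "(-1) ^ weyl_length n w = sign w"
proof -
  have "\<exists>k is. length is = k \<and> set is \<subseteq> {1..<n} \<and> w = word_perm is"
    using permutes_is_word_perm[OF assms] by blast
  then have "\<exists>is. length is = weyl_length n w \<and> set is \<subseteq> {1..<n} \<and> w = word_perm is"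
    unfolding weyl_length_def word_perm_def by (rule LeastI_ex)
  then show ?thesis using sign_word_perm by metis
qed


section \<open>Products of geometric series\<close>

text \<open>Exponent vectors in the expansion of a product of geometric series whose i-th ratio has
  degree d i. The case d = 1 serves the roots that involve the last coordinate, the case d i = i the
  product over the lambda_i.\<close>

definition weighted_comps :: "(nat \<Rightarrow> nat) \<Rightarrow> nat \<Rightarrow> nat \<Rightarrow> (nat \<Rightarrow> nat) set" where
  "weighted_comps d n k = {a. (\<forall>i. i \<notin> {1..n} \<longrightarrow> a i = 0) \<and> (\<Sum>i=1..n. d i * a i) = k}"

lemma finite_weighted_comps:
  assumes "\<And>i. i \<in> {1..n} \<Longrightarrow> d i > 0"
  shows "finite (weighted_comps d n k)"
proof (rule finite_subset)
  show "finite {a :: nat \<Rightarrow> nat. \<forall>i. (i \<in> {1..n} \<longrightarrow> a i \<in> {0..k}) \<and> (i \<notin> {1..n} \<longrightarrow> a i = 0)}"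
    by (rule finite_set_of_finite_funs) auto
  have "a i \<le> k" if "a \<in> weighted_comps d n k" "i \<in> {1..n}" for a i
  proof -
    have "a i \<le> d i * a i" using assms[OF that(2)] by simp
    also have "\<dots> \<le> (\<Sum>i=1..n. d i * a i)"
      by (rule member_le_sum) (use that in auto)
    finally show ?thesis using that by (simp add: weighted_comps_def)
  qed
  then show "weighted_comps d n k \<subseteq>
    {a. \<forall>i. (i \<in> {1..n} \<longrightarrow> a i \<in> {0..k}) \<and> (i \<notin> {1..n} \<longrightarrow> a i = 0)}"
    by (auto simp: weighted_comps_def)
qed

lemma fps_right_inverse_geometric:
  fixes c :: "'a::comm_ring_1"
  assumes "i > 0"
  shows "fps_right_inverse (1 - fps_const c * fps_X ^ i) 1 =
    Abs_fps (\<lambda>k. if i dvd k then c ^ (k div i) else 0)"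
proof -
  let ?f = "1 - fps_const c * fps_X ^ i :: 'a fps"
  let ?g = "Abs_fps (\<lambda>k. if i dvd k then c ^ (k div i) else 0)"
  let ?h = "fps_right_inverse ?f 1"
  have g: "?g * ?f = 1"
  proof (rule fps_ext)
    fix k
    have "?g * ?f = ?g - fps_X ^ i * (fps_const c * ?g)" by (simp add: algebra_simps)
    then have *: "fps_nth (?g * ?f) k =
        fps_nth ?g k - (if k < i then 0 else c * fps_nth ?g (k - i))"
      by (simp add: fps_X_power_mult_nth)
    show "fps_nth (?g * ?f) k = fps_nth 1 k"
    proof (cases "k < i")
      case True
      then show ?thesis unfolding * using assms by (auto simp: fps_one_nth dest: dvd_imp_le)
    next
      case False
      then obtain j where j: "k = i + j" using le_Suc_ex not_less by blast
      then show ?thesis unfolding * using assms by (auto simp: fps_one_nth)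
    qed
  qed
  have "fps_nth ?f 0 = 1" using assms by simp
  then have "?f * ?h = 1" by (intro fps_right_inverse) simp
  then have "?g = ?g * (?f * ?h)" by simp
  also have "\<dots> = ?h" by (simp only: mult.assoc[symmetric] g mult_1_left)
  finally show ?thesis by simp
qed

lemma fps_nth_prod_geometric:
  fixes c :: "nat \<Rightarrow> 'a::comm_ring_1"
  assumes "\<And>i. i \<in> {1..n} \<Longrightarrow> d i > 0"
  shows "fps_nth (\<Prod>i=1..n. fps_right_inverse (1 - fps_const (c i) * fps_X ^ d i) 1) k =
    (\<Sum>a\<in>weighted_comps d n k. \<Prod>i=1..n. c i ^ a i)"
  using assms
proof (induction n arbitrary: k)
  case 0
  have "weighted_comps d 0 k = (if k = 0 then {\<lambda>_. 0} else {})"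
    by (auto simp: weighted_comps_def)
  then show ?case by (simp add: fps_one_nth)
next
  case (Suc n)
  let ?D = "d (Suc n)" and ?J = "\<lambda>k. {j\<in>{0..k}. d (Suc n) dvd k - j}"
  have D: "?D > 0" using Suc.prems by simp
  have "fps_nth (\<Prod>i=1..Suc n. fps_right_inverse (1 - fps_const (c i) * fps_X ^ d i) 1) k =
    (\<Sum>j=0..k. (\<Sum>a\<in>weighted_comps d n j. \<Prod>i=1..n. c i ^ a i) *
       (if ?D dvd k - j then c (Suc n) ^ ((k - j) div ?D) else 0))"
    using Suc D by (simp add: fps_mult_nth fps_right_inverse_geometric)
  also have "\<dots> = (\<Sum>j\<in>?J k. (\<Sum>a\<in>weighted_comps d n j. \<Prod>i=1..n. c i ^ a i) *
       c (Suc n) ^ ((k - j) div ?D))"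
    by (rule sum.mono_neutral_cong_right) auto
  also have "\<dots> = (\<Sum>(j, a)\<in>Sigma (?J k) (weighted_comps d n).
       (\<Prod>i=1..n. c i ^ a i) * c (Suc n) ^ ((k - j) div ?D))"
    unfolding sum_distrib_right
    by (rule sum.Sigma) (use Suc.prems in \<open>auto intro!: finite_weighted_comps\<close>)
  also have "\<dots> = (\<Sum>a\<in>weighted_comps d (Suc n) k. \<Prod>i=1..Suc n. c i ^ a i)"
  \<comment> \<open>Here j is the degree contributed by the first n factors; the exponent of the
    last factor is then forced.\<close>
  proof (rule sum.reindex_bij_witness[where
      i = "\<lambda>a. (k - ?D * a (Suc n), a(Suc n := 0))" and
      j = "\<lambda>(j, a). a(Suc n := (k - j) div ?D)"], goal_cases)
    case (1 x)
    then show ?case by (auto simp: weighted_comps_def)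
  next
    case (2 x)
    then obtain j a where ja: "x = (j, a)" "j \<le> k" "?D dvd k - j" "a \<in> weighted_comps d n j" by auto
    have "(\<Sum>i=1..n. d i * (a(Suc n := (k - j) div ?D)) i) = (\<Sum>i=1..n. d i * a i)"
      by (rule sum.cong) auto
    then show ?case using ja by (auto simp: weighted_comps_def)
  next
    case (3 a)
    then show ?case using D by (auto simp: weighted_comps_def)
  next
    case (4 a)
    have "(\<Sum>i=1..n. d i * (a(Suc n := 0)) i) = (\<Sum>i=1..n. d i * a i)"
      by (rule sum.cong) auto
    then show ?case using 4 by (auto simp: weighted_comps_def)
  next
    case (5 x)
    then show ?case by (auto intro!: prod.cong)
  qed
  finally show ?case .
qed


section \<open>Kostant's partition function\<close>

lemma sum_fun_apply: "sum f A x = (\<Sum>i\<in>A. f i x)"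
  by (induction A rule: infinite_finite_induct) simp_all

lemma expo_power: "(expo \<nu> :: cochar \<Rightarrow>\<^sub>0 'a::comm_ring_1) ^ k = expo (\<lambda>i. int k * \<nu> i)"
proof (induction k)
  case 0
  then show ?case by (simp add: expo_def flip: zero_fun_def)
next
  case (Suc k)
  then show ?case
    by (simp add: expo_def mult_single plus_fun_def algebra_simps)
qed

lemma prod_expo: "finite A \<Longrightarrow> (\<Prod>i\<in>A. expo (\<nu> i) :: cochar \<Rightarrow>\<^sub>0 'a::comm_ring_1) = expo (sum \<nu> A)"
proof (induction A rule: finite_induct)
  case (insert x A)
  then show ?case unfolding prod.insert[OF insert(1,2)] sum.insert[OF insert(1,2)] insert(3)
    by (simp only: expo_def mult_single mult_1)
qed (simp add: expo_def del: sum.empty, simp only: sum.empty single_one)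

lemma lookup_mult_expo:
  "Poly_Mapping.lookup ((p :: cochar \<Rightarrow>\<^sub>0 'a::comm_ring_1) * expo \<beta>) \<nu> = Poly_Mapping.lookup p (\<nu> - \<beta>)"
proof -
  have "(\<Sum>q. Poly_Mapping.lookup (expo \<beta> :: cochar \<Rightarrow>\<^sub>0 'a) q when \<nu> = l + q) = (1 when l = \<nu> - \<beta>)" for l
  proof -
    have "(\<lambda>q. Poly_Mapping.lookup (expo \<beta> :: cochar \<Rightarrow>\<^sub>0 'a) q when \<nu> = l + q) =
        (\<lambda>q. (1 when l = \<nu> - \<beta>) when q = \<beta>)"
    proof
      fix q
      have "\<nu> = l + \<beta> \<longleftrightarrow> l = \<nu> - \<beta>" by auto
      then show "(Poly_Mapping.lookup (expo \<beta> :: cochar \<Rightarrow>\<^sub>0 'a) q when \<nu> = l + q) =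
          ((1 when l = \<nu> - \<beta>) when q = \<beta>)"
        by (cases "q = \<beta>") (simp_all add: expo_def lookup_single when_def)
    qed
    then show ?thesis by (simp only: Sum_any_when_equal)
  qed
  then show ?thesis by (simp add: lookup_mult mult_when)
qed

lemma positive_roots_Suc:
  "positive_roots (Suc n) = positive_roots n \<union> (\<lambda>i. (i, Suc n)) ` {1..n}"
  by (auto simp: positive_roots_def)

lemma finite_positive_roots: "finite (positive_roots n)"
  by (rule finite_subset[of _ "{1..n} \<times> {1..n}"]) (auto simp: positive_roots_def)

text \<open>The new factors belong to the roots (i, n + 1). The power \<open>fps_X ^ 1\<close> is
  written out so that \<open>fps_nth_prod_geometric\<close> applies with all degrees equal to
  1.\<close>

lemma kostant_series_Suc:
  "kostant_series (Suc n) = kostant_series n *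
     (\<Prod>i=1..n. fps_right_inverse (1 - fps_const (expo (eps (Suc n) - eps i)) * fps_X ^ 1) 1)"
proof -
  have "positive_roots n \<inter> (\<lambda>i. (i, Suc n)) ` {1..n} = {}" by (auto simp: positive_roots_def)
  moreover have "inj_on (\<lambda>i. (i, Suc n)) {1..n}" by (auto simp: inj_on_def)
  ultimately show ?thesis
    unfolding kostant_series_def positive_roots_Suc
    by (subst prod.union_disjoint)
       (simp_all add: finite_positive_roots prod.reindex coroot_def mult.commute)
qed

text \<open>Serves to show that the rank n series contributes nothing to coordinate n + 1, so that
  this coordinate comes from the roots (i, n + 1) alone.\<close>

lemma keys_kostant_series:
  "\<nu> \<in> Poly_Mapping.keys (fps_nth (kostant_series n) k) \<Longrightarrow> \<nu> \<in> cochars n"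
proof (induction n arbitrary: k \<nu>)
  case 0
  have "kostant_series 0 = 1" 
    by (simp add: kostant_series_def positive_roots_def cong: conj_cong)
  then show ?case using 0 by (auto simp: fps_one_nth cochars_def split: if_splits)
next
  case (Suc n)
  let ?\<beta> = "\<lambda>a. \<Sum>i=1..n. (\<lambda>j. int (a i) * (eps (Suc n) - eps i) j)"
  have "\<nu> \<in> Poly_Mapping.keys (\<Sum>j=0..k. fps_nth (kostant_series n) j *
      (\<Sum>a\<in>weighted_comps (\<lambda>_. 1) n (k - j). expo (?\<beta> a)))"
    using Suc.prems
    by (simp only: kostant_series_Suc fps_mult_nth fps_nth_prod_geometric[of n "\<lambda>_. 1"] zero_less_one
       expo_power prod_expo finite_atLeastAtMost)
  then obtain j where "\<nu> \<in> Poly_Mapping.keys (fps_nth (kostant_series n) j *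
      (\<Sum>a\<in>weighted_comps (\<lambda>_. 1) n (k - j). expo (?\<beta> a)))"
    using keys_sum by fast
  then obtain x y where xy: "\<nu> = x + y" "x \<in> Poly_Mapping.keys (fps_nth (kostant_series n) j)"
    "y \<in> Poly_Mapping.keys (\<Sum>a\<in>weighted_comps (\<lambda>_. 1) n (k - j). expo (?\<beta> a) :: cochar \<Rightarrow>\<^sub>0 int)"
    using keys_mult by blast
  from xy(3) obtain a where "y \<in> Poly_Mapping.keys (expo (?\<beta> a) :: cochar \<Rightarrow>\<^sub>0 int)"
    using keys_sum by fast
  then have "y = ?\<beta> a" by (simp add: expo_def)
  then have "y \<in> cochars (Suc n)"
    by (auto simp: cochars_def eps_def sum_fun_apply intro!: sum.neutral)
  then show ?case using Suc.IH[OF xy(2)] xy(1) by (auto simp: cochars_def)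
qed

text \<open>Using the negative coroot of (i, n + 1) a_i times moves a_i units from coordinate i to
  coordinate n + 1.\<close>

lemma sum_simple_coroots:
  assumes "a \<in> weighted_comps (\<lambda>_. 1) n k"
  shows "(\<Sum>i=1..n. (\<lambda>j. int (a i) * (eps (Suc n) - eps i) j)) =
    (\<lambda>j. if j = Suc n then int k else - int (a j))"
proof
  fix j
  have a: "a i = 0" if "i \<notin> {1..n}" for i using assms that by (simp add: weighted_comps_def)
  have e: "int (a i) * eps i j = (if j = i then int (a i) else 0)" for i by (simp add: eps_def)
  have "(\<Sum>i=1..n. int (a i) * (eps (Suc n) - eps i) j) =
     int (\<Sum>i=1..n. a i) * eps (Suc n) j - (\<Sum>i=1..n. if j = i then int (a i) else 0)"
    by (simp add: right_diff_distrib sum_subtractf sum_distrib_right e del: sum.delta sum.delta')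
  also have "\<dots> = (if j = Suc n then int k else - int (a j))"
    using assms a[of j] by (auto simp: weighted_comps_def eps_def)
  finally show "(\<Sum>i=1..n. (\<lambda>j. int (a i) * (eps (Suc n) - eps i) j)) j =
    (if j = Suc n then int k else - int (a j))" by (simp add: sum_fun_apply)
qed

text \<open>A composition a records how often each root (i, n + 1) is used. Coordinate n + 1 is
  thereby used up, and the other coordinates rise to nu_i + a_i, which remains to be partitioned by
  the roots of GL(n).\<close>

lemma kostant_P_Suc:
  "kostant_P (Suc n) \<nu> = (if \<nu> (Suc n) < 0 then 0 else
     monom 1 (nat (\<nu> (Suc n))) * (\<Sum>a\<in>weighted_comps (\<lambda>_. 1) n (nat (\<nu> (Suc n))).
       kostant_P n (\<lambda>i. if i = Suc n then 0 else \<nu> i + int (a i))))"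
proof (rule poly_eqI)
  fix k
  let ?S = "\<lambda>j \<nu>. Poly_Mapping.lookup (fps_nth (kostant_series n) j) \<nu>"
  let ?C = "weighted_comps (\<lambda>_. 1) n"
  let ?\<nu> = "\<lambda>a i. if i = Suc n then 0 else \<nu> i + int (a i)"
  have zero: "?S j \<kappa> = 0" if "\<kappa> (Suc n) \<noteq> 0" for j \<kappa>
    using keys_kostant_series[of \<kappa> n j] that by (force simp: cochars_def in_keys_iff)
  have "coeff (kostant_P (Suc n) \<nu>) k =
    (\<Sum>j=0..k. \<Sum>a\<in>?C (k - j). ?S j (\<nu> - (\<Sum>i=1..n. (\<lambda>j. int (a i) * (eps (Suc n) - eps i) j))))"
    by (simp only: coeff_kostant_P kostant_series_Suc fps_mult_nth
       fps_nth_prod_geometric[of n "\<lambda>_. 1"] zero_less_one expo_power prod_expo finite_atLeastAtMost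
       lookup_sum sum_distrib_left lookup_mult_expo)
  also have "\<dots> = (\<Sum>j=0..k. \<Sum>a\<in>?C (k - j).
      ?S j (\<lambda>i. if i = Suc n then \<nu> i - int (k - j) else \<nu> i + int (a i)))"
    by (intro sum.cong refl arg_cong2[where f = ?S])
       (simp_all only: sum_simple_coroots, auto simp: fun_eq_iff)
  also have "\<dots> = (\<Sum>j=0..k. if \<nu> (Suc n) = int (k - j) then \<Sum>a\<in>?C (k - j). ?S j (?\<nu> a) else 0)"
    by (intro sum.cong refl) (auto intro!: sum.neutral zero sum.cong arg_cong2[where f = ?S])
  also have "\<dots> = (if \<nu> (Suc n) < 0 \<or> \<nu> (Suc n) > int k then 0
      else \<Sum>a\<in>?C (nat (\<nu> (Suc n))). ?S (k - nat (\<nu> (Suc n))) (?\<nu> a))"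
  proof (cases "\<nu> (Suc n) < 0 \<or> \<nu> (Suc n) > int k")
    case True
    then show ?thesis by (auto intro!: sum.neutral)
  next
    case False
    \<comment> \<open>The degree j left for the rank n series is now determined, so the outer sum
      collapses to one term.\<close>
    have "(\<Sum>j=0..k. if \<nu> (Suc n) = int (k - j) then \<Sum>a\<in>?C (k - j). ?S j (?\<nu> a) else 0) =
      (\<Sum>j=0..k. if j = k - nat (\<nu> (Suc n)) then \<Sum>a\<in>?C (k - j). ?S j (?\<nu> a) else 0)"
      by (rule sum.cong) (use False in auto)
    then show ?thesis using False by (auto simp: sum.delta nat_le_iff)
  qed
  also have "\<dots> = coeff (if \<nu> (Suc n) < 0 then 0 else monom 1 (nat (\<nu> (Suc n))) *
      (\<Sum>a\<in>?C (nat (\<nu> (Suc n))). kostant_P n (?\<nu> a))) k"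
    by (auto simp: coeff_monom_mult coeff_sum coeff_kostant_P)
  finally show "coeff (kostant_P (Suc n) \<nu>) k = coeff (if \<nu> (Suc n) < 0 then 0 else
     monom 1 (nat (\<nu> (Suc n))) * (\<Sum>a\<in>?C (nat (\<nu> (Suc n))). kostant_P n (?\<nu> a))) k" .
qed


section \<open>Alternating sums and straightening\<close>

text \<open>The shape of \<open>kostka_K\<close> with lambda + rho replaced by any
  \<open>\<gamma>\<close> and the dependence on mu moved into F. Arbitrary \<open>\<gamma>\<close>
  are wanted because the compositions that arise are not sorted.\<close>

definition alternating :: "nat \<Rightarrow> (cochar \<Rightarrow> int poly) \<Rightarrow> cochar \<Rightarrow> int poly" where
  "alternating n F \<gamma> = (\<Sum>w | w permutes {1..n}. of_int (sign w) * F (\<gamma> \<circ> w))"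

text \<open>Substituting s w for w, with s the transposition, permutes the summands and reverses
  every sign.\<close>

lemma alternating_transpose:
  assumes "i \<in> {1..n}" "j \<in> {1..n}" "i \<noteq> j"
  shows "alternating n F (\<gamma> \<circ> Transposition.transpose i j) = - alternating n F \<gamma>"
proof -
  let ?s = "Transposition.transpose i j"
  have "alternating n F \<gamma> = (\<Sum>w | w permutes {1..n}. of_int (sign (?s \<circ> w)) * F (\<gamma> \<circ> (?s \<circ> w)))"
    unfolding alternating_def
    by (rule setum_permutations_compose_left) (use assms in \<open>simp add: permutes_swap_id\<close>)
  also have "\<dots> = (\<Sum>w | w permutes {1..n}. - (of_int (sign w) * F ((\<gamma> \<circ> ?s) \<circ> w)))"
  proof (rule sum.cong)
    fix w assume "w \<in> {w. w permutes {1..n}}"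
    then have "permutation w" by (auto intro: permutes_imp_permutation[rotated])
    then have "sign (?s \<circ> w) = - sign w"
      using assms by (simp add: sign_compose permutation_swap_id sign_swap_id)
    then show "of_int (sign (?s \<circ> w)) * F (\<gamma> \<circ> (?s \<circ> w)) = - (of_int (sign w) * F ((\<gamma> \<circ> ?s) \<circ> w))"
      by (simp add: o_assoc)
  qed simp
  finally show ?thesis by (simp add: alternating_def sum_negf)
qed

text \<open>This is the case \<open>h\<^sub>k s\<^sub>0 = s\<^sub>k\<close> of Pieri's rule. The compositions not concentrated at \<open>n\<close>
  cancel in pairs: with \<open>j\<close> the least index such that \<open>a\<^sub>j > 0\<close>, exchange the entries \<open>j\<close> and \<open>j + 1\<close>
  of \<open>i \<mapsto> i + a\<^sub>i\<close>.\<close>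

lemma sum_alternating_comps:
  assumes "n \<ge> 1"
  shows "(\<Sum>a\<in>weighted_comps (\<lambda>_. 1) n k. alternating n F (\<lambda>i. int i + int (a i))) =
    alternating n F (\<lambda>i. int i + (if i = n then int k else 0))"
proof -
  let ?C = "weighted_comps (\<lambda>_. 1) n k" and ?e = "\<lambda>i. if i = n then k else 0"
  let ?G = "\<lambda>a. alternating n F (\<lambda>i. int i + int (a i))"
  define j where "j = (\<lambda>a :: nat \<Rightarrow> nat. LEAST j. a j > 0)"
  \<comment> \<open>Exchanging the entries j + a_j and j + 1 + a_{j+1}, then subtracting the index
    again, leaves a_{j+1} + 1 at j and a_j - 1 at j + 1. Since a_j > 0, the subtraction is exact;
    since a_{j+1} + 1 > 0, the least positive index stays j, which makes \<open>\<phi>\<close> an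
    involution.\<close>
  define \<phi> where "\<phi> = (\<lambda>a. a(j a := a (Suc (j a)) + 1, Suc (j a) := a (j a) - 1))"
  have \<phi>_eq: "\<phi> a = a(j a := a (Suc (j a)) + 1, Suc (j a) := a (j a) - 1)" for a
    by (simp only: \<phi>_def)
  have e: "?e \<in> ?C" using assms by (auto simp: weighted_comps_def)
  have fin: "finite ?C" by (rule finite_weighted_comps) simp
  have j: "j a \<in> {1..<n}" "a (j a) > 0" "\<And>i. i < j a \<Longrightarrow> a i = 0" if "a \<in> ?C - {?e}" for a
  proof -
    have a: "a i = 0" if "i \<notin> {1..n}" for i using \<open>a \<in> _\<close> that by (simp add: weighted_comps_def)
    have "\<exists>i<n. a i > 0"
    proof (rule ccontr)
      assume "\<not> ?thesis"
      then have 0: "a i = 0" if "i \<noteq> n" for i using a[of i] that by (cases "i < n") auto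
      have "k = (\<Sum>i=1..n. a i)" using that by (simp add: weighted_comps_def)
      also have "\<dots> = (\<Sum>i\<in>{n}. a i)" by (rule sum.mono_neutral_right) (use assms 0 in auto)
      finally show False using that 0 by auto
    qed
    then obtain i where i: "i < n" "a i > 0" by blast
    show "a (j a) > 0" unfolding j_def by (rule LeastI) (rule i(2))
    moreover have "j a \<le> i" unfolding j_def by (rule Least_le) (rule i(2))
    ultimately show "j a \<in> {1..<n}" using i a[of "j a"] by auto
    show "a i = 0" if "i < j a" for i using not_less_Least[OF that[unfolded j_def]] by simp
  qed
  have j_\<phi>: "j (\<phi> a) = j a" if "a \<in> ?C - {?e}" for a
  proof -
    have "(LEAST i. \<phi> a i > 0) = j a"
    proof (rule Least_equality)
      show "j a \<le> i" if "\<phi> a i > 0" for i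
        using that j(3)[OF \<open>a \<in> _\<close>, of i] 
        by (cases "i < j a") (auto simp: \<phi>_def)
    qed (simp add: \<phi>_def)
    then show ?thesis by (simp add: j_def)
  qed
  have \<phi>_C: "\<phi> a \<in> ?C - {?e}" if "a \<in> ?C - {?e}" for a
  proof -
    have J: "j a \<in> {1..n}" "Suc (j a) \<in> {1..n} - {j a}" using j[OF that] by auto
    have *: "sum f {1..n} = f (j a) + (f (Suc (j a)) + sum f ({1..n} - {j a} - {Suc (j a)}))"
      for f :: "nat \<Rightarrow> nat"
      using J by (simp only: sum.remove[of _ "j a"] sum.remove[of _ "Suc (j a)"] finite_Diff finite_atLeastAtMost)
    have "sum (\<phi> a) {1..n} = sum a {1..n}"
      unfolding *[of "\<phi> a"] *[of a] using j[OF that] by (simp add: \<phi>_def)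
    moreover have "\<phi> a (j a) > 0" by (simp add: \<phi>_def)
    then have "\<phi> a \<noteq> ?e" using j(1)[OF that] by (metis atLeastLessThan_iff less_irrefl)
    moreover have "\<phi> a i = 0" if "i \<notin> {1..n}" for i
      using that J \<open>a \<in> _\<close> by (auto simp: \<phi>_def weighted_comps_def)
    ultimately show ?thesis using that by (simp add: weighted_comps_def)
  qed
  have \<phi>_\<phi>: "\<phi> (\<phi> a) = a" if "a \<in> ?C - {?e}" for a
    using j_\<phi>[OF that] j[OF that] unfolding \<phi>_eq[of "\<phi> a"]
    by (simp add: \<phi>_eq[of a] fun_eq_iff)
  have G_\<phi>: "?G (\<phi> a) = - ?G a" if "a \<in> ?C - {?e}" for a
  proof -
    have "(\<lambda>i. int i + int (\<phi> a i)) =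
      (\<lambda>i. int i + int (a i)) \<circ> Transposition.transpose (j a) (Suc (j a))"
      using j[OF that] by (auto simp: fun_eq_iff \<phi>_def Transposition.transpose_def)
    then show ?thesis using j(1)[OF that] by (simp only:) (rule alternating_transpose, auto)
  qed
  have "sum ?G (?C - {?e}) = (\<Sum>a\<in>?C - {?e}. ?G (\<phi> a))"
    by (rule sum.reindex_bij_witness[of _ \<phi> \<phi>]) (use \<phi>_C \<phi>_\<phi> in auto)
  also have "\<dots> = - sum ?G (?C - {?e})" using G_\<phi> by (simp add: sum_negf)
  \<comment> \<open>Fixed points of \<open>\<phi>\<close> (those with a_j = a_{j+1} + 1) are covered
    as well: a sum equal to its own negative vanishes over the integers.\<close>
  finally have "sum ?G (?C - {?e}) = 0" by simp
  then have "sum ?G ?C = ?G ?e" using sum.remove[OF fin e, of ?G] by simp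
  also have "(\<lambda>i. int i + int (?e i)) = (\<lambda>i. int i + (if i = n then int k else 0))" by auto
  finally show ?thesis .
qed


section \<open>The polynomials \<open>K\<close> for one-row weights\<close>

text \<open>Among the negative coroots, coordinate i has i - 1 entries 1 and n - i entries -1; half
  the difference is i - (n + 1)/2.\<close>

lemma rho_neg_eq:
  "rho_neg n i = (if i \<in> {1..n} then of_nat i - (of_nat n + 1) / 2 else 0)"
proof -
  have "(\<Sum>\<alpha>\<in>positive_roots n. of_int (- coroot \<alpha> i) :: rat) =
    (if i \<in> {1..n} then 2 * of_nat i - of_nat n - 1 else 0)"
  proof (induction n)
    case 0
    have "positive_roots 0 = {}" by (auto simp: positive_roots_def)
    then show ?case by simp
  next
    case (Suc n)
    have d: "positive_roots n \<inter> (\<lambda>i. (i, Suc n)) ` {1..n} = {}" by (auto simp: positive_roots_def)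
    have inj: "inj_on (\<lambda>i. (i, Suc n)) {1..n}" by (auto simp: inj_on_def)
    have "(\<Sum>\<alpha>\<in>positive_roots (Suc n). of_int (- coroot \<alpha> i) :: rat) =
      (\<Sum>\<alpha>\<in>positive_roots n. of_int (- coroot \<alpha> i)) +
      (\<Sum>k=1..n. (if i = Suc n then 1 else 0) - (if i = k then 1 else 0))"
      unfolding positive_roots_Suc
      by (subst sum.union_disjoint[OF finite_positive_roots _ d], simp,
          intro arg_cong2[where f = "(+)"] refl, unfold sum.reindex[OF inj])
        (auto simp: coroot_def eps_def intro!: sum.cong)
    then show ?case unfolding Suc.IH by (auto simp: sum_subtractf)
  qed
  then show ?thesis by (simp add: rho_neg_def field_simps)
qed

text \<open>The constant (n + 1)/2 in rho is invariant under W and cancels, so i may stand for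
  rho_i; outside \<open>{1..n}\<close> this is harmless because w fixes those indices. Replacing w
  by its inverse, which has the same sign, turns the Weyl group action into composition with
  w.\<close>

lemma kostka_K_alternating:
  "kostka_K n lam \<mu> =
    alternating n (\<lambda>\<beta>. kostant_P n (\<lambda>i. \<beta> i - \<mu> i - int i)) (\<lambda>i. lam i + int i)"
proof -
  let ?f = "\<lambda>w. (-1) ^ weyl_length n w * kostant_P n
    (\<lambda>i. \<lfloor>weyl_act w (\<lambda>j. of_int (lam j) + rho_neg n j) i - (of_int (\<mu> i) + rho_neg n i)\<rfloor>)"
  have "kostka_K n lam \<mu> = (\<Sum>w | w permutes {1..n}. ?f (inv_into UNIV w))"
    unfolding kostka_K_def by (rule sum_permutations_inverse)
  also have "\<dots> = (\<Sum>w | w permutes {1..n}. of_int (sign w) *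
      kostant_P n (\<lambda>i. ((\<lambda>i. lam i + int i) \<circ> w) i - \<mu> i - int i))"
  proof (intro sum.cong refl arg_cong2[where f = "(*)"] arg_cong[where f = "kostant_P n"] ext)
    fix w assume "w \<in> {w. w permutes {1..n}}"
    then have w: "w permutes {1..n}" by simp
    have "(-1) ^ weyl_length n (inv_into UNIV w) = sign w"
      using minus_one_power_weyl_length[OF permutes_inv[OF w]]
        sign_inverse[OF permutes_imp_permutation[OF _ w]] by simp
    then have "of_int ((-1) ^ weyl_length n (inv_into UNIV w)) = (of_int (sign w) :: int poly)" by (rule arg_cong)
    then show "(-1) ^ weyl_length n (inv_into UNIV w) = (of_int (sign w) :: int poly)" by simp
    fix i
    have "weyl_act (inv_into UNIV w) (\<lambda>j. of_int (lam j) + rho_neg n j) i - (of_int (\<mu> i) + rho_neg n i) =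
      of_int (lam (w i) + int (w i) - \<mu> i - int i)"
    proof (cases "i \<in> {1..n}")
      case True
      then have "w i \<in> {1..n}" using permutes_in_image[OF w] by blast
      with True show ?thesis
        by (simp add: weyl_act_def permutes_inv_inv[OF w] rho_neg_eq del: atLeastAtMost_iff)
    next
      case False
      then have "w i = i" using w by (simp add: permutes_def)
      with False show ?thesis
        by (simp add: weyl_act_def permutes_inv_inv[OF w] rho_neg_eq del: atLeastAtMost_iff)
    qed
    then show "\<lfloor>weyl_act (inv_into UNIV w) (\<lambda>j. of_int (lam j) + rho_neg n j) i - (of_int (\<mu> i) + rho_neg n i)\<rfloor>
      = ((\<lambda>i. lam i + int i) \<circ> w) i - \<mu> i - int i"
      by (simp only: floor_of_int o_apply)
  qed
  finally show ?thesis by (simp add: alternating_def)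
qed

lemma weighted_comps_compose:
  assumes "w permutes {1..n}" "a \<in> weighted_comps (\<lambda>_. 1) n k"
  shows "a \<circ> w \<in> weighted_comps (\<lambda>_. 1) n k"
proof -
  have "(\<Sum>i=1..n. a (w i)) = (\<Sum>i=1..n. a i)"
    by (rule sum.permute[OF assms(1), of a, unfolded o_def, symmetric])
  then show ?thesis using assms
    by (auto simp: weighted_comps_def permutes_def)
qed

lemma kostant_P_0: "kostant_P n (\<lambda>_. 0) = 1"
proof (induction n)
  case 0
  have "positive_roots 0 = {}" by (auto simp: positive_roots_def)
  then have "kostant_series 0 = 1" by (simp add: kostant_series_def)
  then show ?case
    by (intro poly_eqI) (auto simp: coeff_kostant_P fps_one_nth lookup_one coeff_1 zero_fun_def)
next
  case (Suc n)
  have "weighted_comps (\<lambda>_. 1) n 0 = {\<lambda>_. 0}" by (force simp: weighted_comps_def)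
  then show ?case using Suc by (simp add: kostant_P_Suc cong: if_cong)
qed

text \<open>Only the Weyl group elements fixing \<open>n\<close> contribute, since all other coordinates of
  \<open>\<lambda> + \<rho>\<close> are too small; expanding the roots that involve \<open>n\<close> then leaves the straightening
  sum for \<open>GL(n - 1)\<close>.\<close>

lemma kostka_K_one_row:
  assumes "n \<ge> 1" "\<And>i. i \<notin> {1..n} \<Longrightarrow> m i = 0"
  shows "kostka_K n (\<lambda>i. if i = n then int (\<Sum>i=1..n. m i) else 0) (int \<circ> m) =
    monom 1 (\<Sum>i=1..n. (n - i) * m i)"
  using assms
proof (induction n arbitrary: m rule: nat_induct_at_least)
  case base
  have "(\<lambda>i. (if i = Suc 0 then int (sum m {1..1}) else 0) - int (m i)) = (\<lambda>_. 0)"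
    using base by (force simp: fun_eq_iff)
  then show ?case
    by (simp add: kostka_K_alternating alternating_def kostant_P_0 one_pCons[symmetric] monom_0)
next
  case (Suc n)
  let ?k = "\<Sum>i=1..n. m i" and ?m = "m(Suc n := 0)"
  let ?lam = "\<lambda>i. if i = Suc n then int (\<Sum>i=1..Suc n. m i) else 0"
  let ?F = "\<lambda>\<beta>. kostant_P n (\<lambda>i. \<beta> i - int (?m i) - int i)"
  let ?t = "\<lambda>w. of_int (sign w) * kostant_P (Suc n)
      (\<lambda>i. ((\<lambda>i. ?lam i + int i) \<circ> w) i - (int \<circ> m) i - int i)"
  let ?C = "weighted_comps (\<lambda>_. 1) n ?k"
  have m: "?m i = 0" if "i \<notin> {1..n}" for i using Suc.prems that by auto
  have sum_m: "(\<Sum>i=1..n. ?m i) = ?k" by (rule sum.cong) auto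
  have "kostka_K (Suc n) ?lam (int \<circ> m) = (\<Sum>w | w permutes {1..Suc n}. ?t w)"
    by (simp only: kostka_K_alternating alternating_def)
  also have "\<dots> = (\<Sum>w | w permutes {1..n}. ?t w)"
  proof (rule sum.mono_neutral_right)
    show "finite {w. w permutes {1..Suc n}}" by (rule finite_permutations) simp
    show "{w. w permutes {1..n}} \<subseteq> {w. w permutes {1..Suc n}}"
      by (auto intro: permutes_subset)
    show "\<forall>w\<in>{w. w permutes {1..Suc n}} - {w. w permutes {1..n}}. ?t w = 0"
    proof
      fix w assume "w \<in> {w. w permutes {1..Suc n}} - {w. w permutes {1..n}}"
      then have w: "w permutes {1..Suc n}" "\<not> w permutes {1..n}" by auto
      have "w (Suc n) \<noteq> Suc n"
        using permutes_superset[OF w(1), of "{1..n}"] w(2) by (auto simp: le_Suc_eq)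
      moreover have "w (Suc n) \<in> {1..Suc n}" using permutes_in_image[OF w(1)] by simp
      \<comment> \<open>Now w(n + 1) \<le> n, so coordinate n + 1 of the exponent is w(n + 1) -
        m_{n+1} - (n + 1) < 0.\<close>
      ultimately show "?t w = 0" by (subst kostant_P_Suc) auto
    qed
  qed
  also have "\<dots> = (\<Sum>w | w permutes {1..n}. of_int (sign w) *
      (monom 1 ?k * (\<Sum>a\<in>?C. ?F ((\<lambda>i. int i + int (a i)) \<circ> w))))"
  proof (intro sum.cong refl arg_cong2[where f = "(*)"])
    fix w assume "w \<in> {w. w permutes {1..n}}"
    then have w: "w permutes {1..n}" by simp
    then have wn: "w (Suc n) = Suc n" by (simp add: permutes_def)
    have wi: "w i = Suc n \<longleftrightarrow> i = Suc n" for i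
      using permutes_inj[OF w] wn by (metis injD)
    let ?\<nu> = "\<lambda>i. ((\<lambda>i. ?lam i + int i) \<circ> w) i - (int \<circ> m) i - int i"
    have \<nu>: "?\<nu> (Suc n) = int ?k" by (simp add: wn)
    have "kostant_P (Suc n) ?\<nu> =
        monom 1 ?k * (\<Sum>a\<in>?C. kostant_P n (\<lambda>i. if i = Suc n then 0 else ?\<nu> i + int (a i)))"
      by (simp only: kostant_P_Suc[of n ?\<nu>] \<nu> nat_int of_nat_less_0_iff if_False)
    also have "(\<Sum>a\<in>?C. kostant_P n (\<lambda>i. if i = Suc n then 0 else ?\<nu> i + int (a i))) =
        (\<Sum>a\<in>?C. kostant_P n (\<lambda>i. int (w i) + int (a i) - int (?m i) - int i))"
      by (intro sum.cong refl arg_cong[where f = "kostant_P n"])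
        (auto simp: wn wi weighted_comps_def)
    also have "(\<Sum>a\<in>?C. kostant_P n (\<lambda>i. int (w i) + int (a i) - int (?m i) - int i)) =
       (\<Sum>a\<in>?C. ?F ((\<lambda>i. int i + int (a i)) \<circ> w))"
    \<comment> \<open>W permutes the compositions. Writing a as b composed with w makes w(i) + a_i
      the value of \<open>i + b i\<close> at w(i), so w acts on the whole argument of F and the sum
      over w becomes alternating again.\<close>
    proof (rule sum.reindex_bij_witness[where i = "\<lambda>a. a \<circ> w" and j = "\<lambda>a. a \<circ> inv_into UNIV w"], goal_cases)
      case (1 a)
      then show ?case using permutes_inv_o[OF w] by (simp add: o_assoc[symmetric])
    next
      case (2 a)
      then show ?case using weighted_comps_compose[OF permutes_inv[OF w]] by simp
    next
      case (3 a)
      then show ?case using permutes_inv_o[OF w] by (simp add: o_assoc[symmetric])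
    next
      case (4 a)
      then show ?case using weighted_comps_compose[OF w] by simp
    next
      case (5 a)
      then show ?case using permutes_inverses[OF w] by simp
    qed
    finally show "kostant_P (Suc n) (\<lambda>i. ((\<lambda>i. ?lam i + int i) \<circ> w) i - (int \<circ> m) i - int i) =
      monom 1 ?k * (\<Sum>a\<in>?C. ?F ((\<lambda>i. int i + int (a i)) \<circ> w))" .
  qed
  also have "\<dots> = monom 1 ?k * (\<Sum>a\<in>?C. alternating n ?F (\<lambda>i. int i + int (a i)))"
    unfolding alternating_def sum_distrib_left
    by (subst sum.swap) (simp only: mult_ac)
  also have "\<dots> = monom 1 ?k * alternating n ?F (\<lambda>i. int i + (if i = n then int ?k else 0))"
    using Suc.hyps by (simp only: sum_alternating_comps)
  also have "alternating n ?F (\<lambda>i. int i + (if i = n then int ?k else 0)) =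
      kostka_K n (\<lambda>i. if i = n then int (\<Sum>i=1..n. ?m i) else 0) (int \<circ> ?m)"
    unfolding kostka_K_alternating sum_m by (simp add: add.commute)
  also have "\<dots> = monom 1 (\<Sum>i=1..n. (n - i) * ?m i)"
    by (rule Suc.IH) (rule m)
  also have "monom 1 ?k * \<dots> = monom 1 (\<Sum>i=1..n. m i + (n - i) * m i)"
    by (simp add: mult_monom sum.distrib)
  also have "(\<Sum>i=1..n. m i + (n - i) * m i) = (\<Sum>i=1..Suc n. (Suc n - i) * m i)"
    by (simp add: Suc_diff_le)
  finally show ?case .
qed


section \<open>Symmetric powers of the standard representation\<close>

lemma sym_scale_conv_mult: "sym_scale c p = Poly_Mapping.single 0 c * p"
  by (simp add: sym_scale_def mult_map_scale_conv_mult)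

lemma lookup_sym_scale [simp]: "Poly_Mapping.lookup (sym_scale c p) m = c * Poly_Mapping.lookup p m"
  by (simp add: sym_scale_def Poly_Mapping.map.rep_eq when_def)

lemma sym_scale_single [simp]: "sym_scale c (Poly_Mapping.single m a) = Poly_Mapping.single m (c * a)"
  by (simp add: sym_scale_conv_mult mult_single)

interpretation sym: Modules.module sym_scale
  by standard (auto intro!: poly_mapping_eqI simp: lookup_add algebra_simps)

lemma keys_sym_scale: "Poly_Mapping.keys (sym_scale c p) \<subseteq> Poly_Mapping.keys p"
  by (auto simp: in_keys_iff)

lemma single_Suc_0_eq_iff [simp]:
  "Poly_Mapping.single i (Suc 0) = Poly_Mapping.single j (Suc 0) \<longleftrightarrow> i = j"
  by (metis keys_single nat.simps(3) singleton_inject)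

section \<open>Supports of products in the symmetric algebra\<close>

lemma sum_monomials:
  fixes p :: "'a \<Rightarrow>\<^sub>0 'b::comm_monoid_add"
  shows "(\<Sum>m\<in>Poly_Mapping.keys p. Poly_Mapping.single m (Poly_Mapping.lookup p m)) = p"
  by (rule poly_mapping_eqI)
    (auto simp: lookup_sum lookup_single when_def in_keys_iff sum.delta')

lemma lookup_mult_keys:
  fixes p q :: sym_alg
  shows "Poly_Mapping.lookup (p * q) m =
    (\<Sum>(k, l)\<in>Poly_Mapping.keys p \<times> Poly_Mapping.keys q.
      if m = k + l then Poly_Mapping.lookup p k * Poly_Mapping.lookup q l else 0)"
proof -
  have "p * q = (\<Sum>k\<in>Poly_Mapping.keys p. \<Sum>l\<in>Poly_Mapping.keys q.
    Poly_Mapping.single (k + l) (Poly_Mapping.lookup p k * Poly_Mapping.lookup q l))"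
    by (subst (1) sum_monomials[of p, symmetric], subst (1) sum_monomials[of q, symmetric])
      (simp add: sum_product mult_single)
  then have "Poly_Mapping.lookup (p * q) m = (\<Sum>k\<in>Poly_Mapping.keys p. \<Sum>l\<in>Poly_Mapping.keys q.
      if m = k + l then Poly_Mapping.lookup p k * Poly_Mapping.lookup q l else 0)"
    by (simp add: lookup_sum lookup_single when_def eq_commute)
  then show ?thesis by (simp only: sum.cartesian_product)
qed

text \<open>Membership in the nonnegative reals inside the complex numbers: a condition stable under
  products that excludes cancellation.\<close>

definition nonneg_coeffs :: "sym_alg \<Rightarrow> bool" where
  "nonneg_coeffs p \<longleftrightarrow> (\<forall>m. Poly_Mapping.lookup p m \<in> \<real>\<^sub>\<ge>\<^sub>0)"

lemma sum_nonneg_Reals: "(\<And>x. x \<in> A \<Longrightarrow> f x \<in> \<real>\<^sub>\<ge>\<^sub>0) \<Longrightarrow> sum f A \<in> \<real>\<^sub>\<ge>\<^sub>0"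
  by (induction A rule: infinite_finite_induct) auto

lemma nonneg_coeffs_mult:
  assumes "nonneg_coeffs p" "nonneg_coeffs q"
  shows "nonneg_coeffs (p * q)"
  using assms unfolding nonneg_coeffs_def lookup_mult_keys
  by (auto intro!: sum_nonneg_Reals)

lemma nonneg_coeffs_1: "nonneg_coeffs 1"
  by (auto simp: nonneg_coeffs_def lookup_one when_def)

text \<open>The pair (k, l) contributes a positive number to the coefficient of k + l, and all other
  pairs with this sum contribute nonnegative ones.\<close>

lemma keys_mult_nonneg:
  assumes "nonneg_coeffs p" "nonneg_coeffs q"
    and "k \<in> Poly_Mapping.keys p" "l \<in> Poly_Mapping.keys q"
  shows "k + l \<in> Poly_Mapping.keys (p * q)"
proof -
  let ?S = "Poly_Mapping.keys p \<times> Poly_Mapping.keys q"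
  let ?t = "\<lambda>(k', l'). if k + l = k' + l' then Poly_Mapping.lookup p k' * Poly_Mapping.lookup q l' else 0"
  have nn: "?t x \<in> \<real>\<^sub>\<ge>\<^sub>0" for x
    using assms(1,2) by (cases x) (auto simp: nonneg_coeffs_def)
  have "?t (k, l) \<noteq> 0" using assms(3,4) by (auto simp: in_keys_iff)
  moreover have "?t (k, l) \<in> \<real>\<^sub>\<ge>\<^sub>0" by (rule nn)
  ultimately have "0 < Re (?t (k, l))" unfolding complex_nonneg_Reals_iff complex_eq_iff by auto
  also have "\<dots> \<le> (\<Sum>x\<in>?S. Re (?t x))"
    by (rule member_le_sum) (use assms(3,4) nn in \<open>auto simp only: complex_nonneg_Reals_iff finite_cartesian_product finite_keys\<close>)
  also have "\<dots> = Re (Poly_Mapping.lookup (p * q) (k + l))"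
    by (simp only: lookup_mult_keys Re_sum)
  finally show ?thesis by (auto simp: in_keys_iff)
qed

lemma nonneg_coeffs_power: "nonneg_coeffs p \<Longrightarrow> nonneg_coeffs (p ^ r)"
  by (induction r) (auto intro: nonneg_coeffs_mult nonneg_coeffs_1)

subsection \<open>Monomials of a fixed degree\<close>

definition monomials :: "nat \<Rightarrow> nat \<Rightarrow> (nat \<Rightarrow>\<^sub>0 nat) set" where
  "monomials n d = {m. Poly_Mapping.keys m \<subseteq> {1..n} \<and> (\<Sum>i=1..n. Poly_Mapping.lookup m i) = d}"

lemma sym_power_iff: "p \<in> sym_power n d \<longleftrightarrow> Poly_Mapping.keys p \<subseteq> monomials n d"
  by (auto simp: sym_power_def monomials_def)

lemma monomials_add:
  "m \<in> monomials n a \<Longrightarrow> m' \<in> monomials n b \<Longrightarrow> m + m' \<in> monomials n (a + b)"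
  using Poly_Mapping.keys_add[of m m'] by (auto simp: monomials_def lookup_add sum.distrib)

lemma monomials_single: "i \<in> {1..n} \<Longrightarrow> Poly_Mapping.single i r \<in> monomials n r"
  by (auto simp: monomials_def lookup_single when_def)

lemma monomials_0: "monomials n 0 = {0}"
  by (auto simp: monomials_def intro!: poly_mapping_eqI) (metis atLeastAtMost_iff in_keys_iff subsetD)

lemma sum_keys_monomials:
  "m \<in> monomials n d \<Longrightarrow> (\<Sum>i\<in>Poly_Mapping.keys m. Poly_Mapping.lookup m i) = d"
  unfolding monomials_def by (auto intro!: sum.mono_neutral_left simp: in_keys_iff)

lemma monomials_Suc_cases:
  assumes "m \<in> monomials n (Suc d)"
  obtains i m' where "i \<in> {1..n}" "m' \<in> monomials n d" "m = Poly_Mapping.single i 1 + m'"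
proof -
  have "(\<Sum>i=1..n. Poly_Mapping.lookup m i) \<noteq> 0" using assms by (simp add: monomials_def)
  then obtain i where i: "i \<in> {1..n}" "Poly_Mapping.lookup m i \<noteq> 0"
    by (meson sum.not_neutral_contains_not_neutral)
  define m' where "m' = m - Poly_Mapping.single i 1"
  have m: "m = Poly_Mapping.single i 1 + m'"
    using i(2) by (auto intro!: poly_mapping_eqI simp: m'_def lookup_add lookup_minus lookup_single when_def)
  have "Poly_Mapping.keys m' \<subseteq> Poly_Mapping.keys m"
    by (auto simp: m'_def in_keys_iff lookup_minus)
  moreover have "(\<Sum>i=1..n. Poly_Mapping.lookup m i) = 1 + (\<Sum>i=1..n. Poly_Mapping.lookup m' i)"
    unfolding m using i(1) by (simp add: lookup_add sum.distrib lookup_single when_def)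
  ultimately have "m' \<in> monomials n d" using assms by (auto simp: monomials_def)
  with i(1) m that show ?thesis by blast
qed

lemma subspace_sym_power: "sym.subspace (sym_power n d)"
  by (rule sym.subspaceI)
    (auto simp: sym_power_iff dest!: Poly_Mapping.keys_add[THEN subsetD] keys_sym_scale[THEN subsetD])

lemma sym_power_mult:
  assumes "p \<in> sym_power n a" "q \<in> sym_power n b"
  shows "p * q \<in> sym_power n (a + b)"
proof -
  have "Poly_Mapping.keys (p * q) \<subseteq> {k + l | k l. k \<in> Poly_Mapping.keys p \<and> l \<in> Poly_Mapping.keys q}"
    by (rule keys_mult)
  then show ?thesis using assms monomials_add unfolding sym_power_iff by blast
qed

lemma sym_power_1: "1 \<in> sym_power n 0"
  by (simp add: sym_power_iff monomials_0)

lemma sym_power_power: "p \<in> sym_power n a \<Longrightarrow> p ^ r \<in> sym_power n (r * a)"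
  by (induction r) (auto intro: sym_power_mult sym_power_1)

lemma sym_power_prod:
  "finite S \<Longrightarrow> (\<And>j. j \<in> S \<Longrightarrow> f j \<in> sym_power n (r j)) \<Longrightarrow> prod f S \<in> sym_power n (sum r S)"
  by (induction S rule: finite_induct) (auto intro: sym_power_mult sym_power_1)

lemma single_power:
  "(Poly_Mapping.single (Poly_Mapping.single j 1) c :: sym_alg) ^ r =
    Poly_Mapping.single (Poly_Mapping.single j r) (c ^ r)"
  by (induction r) (simp_all add: mult_single flip: single_add)

lemma prod_single:
  "finite S \<Longrightarrow> (\<Prod>j\<in>S. Poly_Mapping.single (m j) (c j) :: sym_alg) =
    Poly_Mapping.single (\<Sum>j\<in>S. m j) (\<Prod>j\<in>S. c j)"
  by (induction S rule: finite_induct) (simp_all add: mult_single)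

lemma std_act_eq:
  "std_act n g j = (\<Sum>i=1..n. Poly_Mapping.single (Poly_Mapping.single i 1) (g $$ (i - 1, j - 1)))"
  by (simp add: std_act_def basis_vec_def)

lemma std_act_in_sym_power: "std_act n g j \<in> sym_power n 1"
  unfolding std_act_eq
  by (intro sym.subspace_sum subspace_sym_power)
    (auto simp: sym_power_iff intro: monomials_single)

lemma sym_act_single:
  "sym_act n g (Poly_Mapping.single m 1) = (\<Prod>j\<in>Poly_Mapping.keys m. std_act n g j ^ Poly_Mapping.lookup m j)"
  by (simp add: sym_act_def)

lemma sym_act_in_sym_power:
  assumes "p \<in> sym_power n d"
  shows "sym_act n g p \<in> sym_power n d"
  unfolding sym_act_def
proof (intro sym.subspace_sum sym.subspace_scale subspace_sym_power)
  fix m assume "m \<in> Poly_Mapping.keys p"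
  then have "m \<in> monomials n d" using assms by (auto simp: sym_power_iff)
  moreover have "(\<Prod>j\<in>Poly_Mapping.keys m. std_act n g j ^ Poly_Mapping.lookup m j) \<in>
    sym_power n (\<Sum>j\<in>Poly_Mapping.keys m. Poly_Mapping.lookup m j)"
    using sym_power_power[OF std_act_in_sym_power, unfolded mult_1_right] by (intro sym_power_prod) auto
  ultimately show "(\<Prod>j\<in>Poly_Mapping.keys m. std_act n g j ^ Poly_Mapping.lookup m j) \<in> sym_power n d"
    by (simp add: sum_keys_monomials)
qed

subsection \<open>Diagonal and triangular matrices\<close>

lemma GL_if_det_nonzero:
  assumes "A \<in> carrier_mat n n" "det A \<noteq> 0"
  shows "A \<in> GL n"
  using det_non_zero_imp_unit[OF assms, of "()"] assms(1)
  by (auto simp: GL_def invertible_mat_def inverts_mat_def Units_def ring_mat_def square_mat.simps)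

definition torus_mat :: "nat \<Rightarrow> (nat \<Rightarrow> complex) \<Rightarrow> complex mat" where
  "torus_mat n t = mat n n (\<lambda>(i, j). if i = j then t (i + 1) else 0)"

text \<open>Sends e_j to e_j + ... + e_n, so every basis vector acquires an e_n component.\<close>

definition lower_ones :: "nat \<Rightarrow> complex mat" where
  "lower_ones n = mat n n (\<lambda>(i, j). if j \<le> i then 1 else 0)"

text \<open>Sends e_n to e_1 + ... + e_n, whose d-th power contains every monomial of degree
  d.\<close>

definition upper_ones :: "nat \<Rightarrow> complex mat" where
  "upper_ones n = mat n n (\<lambda>(i, j). if i \<le> j then 1 else 0)"

lemma torus_mat_borel:
  assumes "\<And>i. i \<in> {1..n} \<Longrightarrow> t i \<noteq> 0"
  shows "torus_mat n t \<in> borel_minus n"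
proof -
  have c: "torus_mat n t \<in> carrier_mat n n" by (simp add: torus_mat_def)
  have "det (torus_mat n t) = (\<Prod>i=0..<n. t (i + 1))"
    by (subst det_lower_triangular[OF _ c]) (auto simp: torus_mat_def prod_list_diag_prod)
  also have "\<dots> \<noteq> 0" using assms by auto
  finally show ?thesis using GL_if_det_nonzero[OF c] by (simp add: borel_minus_def torus_mat_def)
qed

lemma lower_ones_borel: "lower_ones n \<in> borel_minus n"
proof -
  have c: "lower_ones n \<in> carrier_mat n n" by (simp add: lower_ones_def)
  have "det (lower_ones n) = 1"
    by (subst det_lower_triangular[OF _ c]) (auto simp: lower_ones_def prod_list_diag_prod)
  then show ?thesis using GL_if_det_nonzero[OF c] by (simp add: borel_minus_def lower_ones_def)
qed

lemma upper_ones_GL: "upper_ones n \<in> GL n"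
proof -
  have c: "upper_ones n \<in> carrier_mat n n" by (simp add: upper_ones_def)
  have "det (upper_ones n) = 1"
    by (subst det_upper_triangular[OF _ c])
      (auto simp: upper_ones_def prod_list_diag_prod intro: upper_triangularI)
  then show ?thesis using GL_if_det_nonzero[OF c] by simp
qed

lemma lookup_sym_act_torus:
  assumes "p \<in> sym_power n d"
  shows "Poly_Mapping.lookup (sym_act n (torus_mat n t) p) m =
    (\<Prod>j=1..n. t j ^ Poly_Mapping.lookup m j) * Poly_Mapping.lookup p m"
proof -
  have *: "(\<Prod>j\<in>Poly_Mapping.keys m. std_act n (torus_mat n t) j ^ Poly_Mapping.lookup m j) =
    Poly_Mapping.single m (\<Prod>j=1..n. t j ^ Poly_Mapping.lookup m j)"
    if "m \<in> Poly_Mapping.keys p" for m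
  proof -
    have k: "Poly_Mapping.keys m \<subseteq> {1..n}" using that assms by (auto simp: sym_power_iff monomials_def)
    have "std_act n (torus_mat n t) j = Poly_Mapping.single (Poly_Mapping.single j 1) (t j)"
      if "j \<in> {1..n}" for j
    proof -
      have "std_act n (torus_mat n t) j =
        (\<Sum>i=1..n. if i = j then Poly_Mapping.single (Poly_Mapping.single i 1) (t j) else 0)"
        unfolding std_act_eq by (rule sum.cong) (use that in \<open>auto simp: torus_mat_def\<close>)
      then show ?thesis using that by simp
    qed
    then have "(\<Prod>j\<in>Poly_Mapping.keys m. std_act n (torus_mat n t) j ^ Poly_Mapping.lookup m j) =
      (\<Prod>j\<in>Poly_Mapping.keys m. Poly_Mapping.single (Poly_Mapping.single j (Poly_Mapping.lookup m j))
         (t j ^ Poly_Mapping.lookup m j))"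
      using k by (intro prod.cong refl) (simp only: single_power subsetD)
    also have "\<dots> = Poly_Mapping.single m (\<Prod>j\<in>Poly_Mapping.keys m. t j ^ Poly_Mapping.lookup m j)"
      by (simp add: prod_single sum_monomials)
    also have "(\<Prod>j\<in>Poly_Mapping.keys m. t j ^ Poly_Mapping.lookup m j) =
      (\<Prod>j=1..n. t j ^ Poly_Mapping.lookup m j)"
      by (rule prod.mono_neutral_left) (use k in \<open>auto simp: in_keys_iff\<close>)
    finally show ?thesis .
  qed
  have "sym_act n (torus_mat n t) p = (\<Sum>m\<in>Poly_Mapping.keys p.
      Poly_Mapping.single m ((\<Prod>j=1..n. t j ^ Poly_Mapping.lookup m j) * Poly_Mapping.lookup p m))"
    unfolding sym_act_def by (intro sum.cong refl) (simp add: * mult.commute)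
  then show ?thesis by (auto simp: lookup_sum lookup_single when_def in_keys_iff sum.delta')
qed

text \<open>Choosing the summand e_n in each of the d linear factors of the image produces
  e_n^d.\<close>

lemma sym_act_lower_ones:
  assumes "m \<in> monomials n d" "n \<ge> 1"
  shows "Poly_Mapping.single n d \<in> Poly_Mapping.keys (sym_act n (lower_ones n) (Poly_Mapping.single m 1))"
proof -
  let ?L = "std_act n (lower_ones n)"
  have L: "Poly_Mapping.lookup (?L j) k = (if \<exists>i\<in>{j..n}. k = Poly_Mapping.single i 1 then 1 else 0)"
    if "j \<in> {1..n}" for j k
  proof -
    have "Poly_Mapping.lookup (?L j) k =
        (\<Sum>i=1..n. if j \<le> i \<and> k = Poly_Mapping.single i 1 then 1 else 0)"
      unfolding std_act_eq lookup_sum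
      by (rule sum.cong) (use that in \<open>auto simp: lower_ones_def lookup_single when_def\<close>)
    also have "\<dots> = (if \<exists>i\<in>{j..n}. k = Poly_Mapping.single i 1 then 1 else 0)"
    proof (cases "\<exists>i\<in>{j..n}. k = Poly_Mapping.single i 1")
      case True
      then obtain i where i: "i \<in> {j..n}" "k = Poly_Mapping.single i 1" by blast
      have "(\<Sum>i=1..n. if j \<le> i \<and> k = Poly_Mapping.single i 1 then 1 else 0) =
        (\<Sum>i'=1..n. if i' = i then 1 else (0::complex))"
        by (rule sum.cong) (use i in auto)
      then show ?thesis using True i that by simp
    qed (auto intro!: sum.neutral)
    finally show ?thesis .
  qed
  have key: "Poly_Mapping.single n r \<in> Poly_Mapping.keys (?L j ^ r) \<and> nonneg_coeffs (?L j ^ r)"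
    if "j \<in> {1..n}" for j r
  proof (induction r)
    case (Suc r)
    have "nonneg_coeffs (?L j)" using that by (simp add: nonneg_coeffs_def L)
    moreover have "Poly_Mapping.single n 1 \<in> Poly_Mapping.keys (?L j)"
      using that by (auto simp: in_keys_iff L)
    ultimately have "Poly_Mapping.single n 1 + Poly_Mapping.single n r \<in> Poly_Mapping.keys (?L j * ?L j ^ r)"
      "nonneg_coeffs (?L j * ?L j ^ r)"
      using Suc by (auto intro: keys_mult_nonneg nonneg_coeffs_mult)
    then show ?case by (simp flip: single_add)
  qed (simp add: nonneg_coeffs_1)
  have "Poly_Mapping.single n (sum r S) \<in> Poly_Mapping.keys (\<Prod>j\<in>S. ?L j ^ r j) \<and>
      nonneg_coeffs (\<Prod>j\<in>S. ?L j ^ r j)" if "finite S" "S \<subseteq> {1..n}" for S r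
    using that
  proof (induction S rule: finite_induct)
    case (insert j S)
    then have "Poly_Mapping.single n (r j) + Poly_Mapping.single n (sum r S) \<in>
        Poly_Mapping.keys (?L j ^ r j * (\<Prod>j\<in>S. ?L j ^ r j))"
      "nonneg_coeffs (?L j ^ r j * (\<Prod>j\<in>S. ?L j ^ r j))"
      using key[of j "r j"] by (auto intro!: keys_mult_nonneg nonneg_coeffs_mult)
    then show ?case using insert by (simp flip: single_add)
  qed (simp add: nonneg_coeffs_1)
  from this[of "Poly_Mapping.keys m" "Poly_Mapping.lookup m"] show ?thesis
    using assms sum_keys_monomials[OF assms(1)] by (auto simp: sym_act_single monomials_def)
qed

lemma sym_act_upper_ones:
  assumes "n \<ge> 1"
  shows "monomials n d \<subseteq>
    Poly_Mapping.keys (sym_act n (upper_ones n) (Poly_Mapping.single (Poly_Mapping.single n d) 1))"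
proof -
  let ?L = "std_act n (upper_ones n) n"
  have L: "?L = (\<Sum>i=1..n. Poly_Mapping.single (Poly_Mapping.single i 1) 1)"
    unfolding std_act_eq by (rule sum.cong) (auto simp: upper_ones_def)
  have nn: "nonneg_coeffs ?L"
    unfolding L nonneg_coeffs_def lookup_sum by (auto intro!: sum_nonneg_Reals simp: lookup_single when_def)
  have key: "Poly_Mapping.single i 1 \<in> Poly_Mapping.keys ?L" if "i \<in> {1..n}" for i
  proof -
    have "Poly_Mapping.lookup ?L (Poly_Mapping.single i 1) = (\<Sum>i'=1..n. if i' = i then 1 else 0)"
      unfolding L lookup_sum by (rule sum.cong) (auto simp: lookup_single when_def)
    then show ?thesis using that by (simp add: in_keys_iff)
  qed
  have "monomials n d \<subseteq> Poly_Mapping.keys (?L ^ d)"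
  proof (induction d)
    case 0
    show ?case by (simp add: monomials_0)
  next
    case (Suc d)
    show ?case
    proof
      fix m assume "m \<in> monomials n (Suc d)"
      then obtain i m' where "i \<in> {1..n}" "m' \<in> monomials n d" "m = Poly_Mapping.single i 1 + m'"
        by (rule monomials_Suc_cases)
      then show "m \<in> Poly_Mapping.keys (?L ^ Suc d)"
        using Suc nn key by (auto intro!: keys_mult_nonneg nonneg_coeffs_power)
    qed
  qed
  moreover have "sym_act n (upper_ones n) (Poly_Mapping.single (Poly_Mapping.single n d) 1) = ?L ^ d"
    unfolding sym_act_single by (cases "d = 0") simp_all
  ultimately show ?thesis by simp
qed


subsection \<open>Irreducibility\<close>

text \<open>Elements of the torus separate the monomials, so a subrepresentation is spanned by
  monomials.\<close>

lemma subrep_monomial: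
  assumes "subrep n sym_scale (sym_act n) W"
    and "v \<in> W" "v \<in> sym_power n d" "m \<in> Poly_Mapping.keys v"
  shows "Poly_Mapping.single m 1 \<in> W"
  using assms(2-)
proof (induction "card (Poly_Mapping.keys v)" arbitrary: v rule: less_induct)
  case less
  have sub: "sym.subspace W" and act: "\<And>g u. g \<in> GL n \<Longrightarrow> u \<in> W \<Longrightarrow> sym_act n g u \<in> W"
    using assms(1) by (auto simp: subrep_def)
  show ?case
  proof (cases "Poly_Mapping.keys v = {m}")
    case True
    then have "v = Poly_Mapping.single m (Poly_Mapping.lookup v m)"
      using sum_monomials[of v] by simp
    then have "sym_scale (1 / Poly_Mapping.lookup v m) v = Poly_Mapping.single m 1"
      using less.prems(3) by (metis in_keys_iff nonzero_divide_eq_eq sym_scale_single)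
    then show ?thesis using sym.subspace_scale[OF sub less.prems(1)] by metis
  next
    case False
    then obtain m' where m': "m' \<in> Poly_Mapping.keys v" "m' \<noteq> m" using less.prems(3) by blast
    then obtain i where i: "Poly_Mapping.lookup m' i \<noteq> Poly_Mapping.lookup m i"
      using poly_mapping_eqI[of m' m] by auto
    have mon: "m \<in> monomials n d" "m' \<in> monomials n d"
      using less.prems m'(1) by (auto simp: sym_power_iff)
    from i have "i \<in> Poly_Mapping.keys m' \<or> i \<in> Poly_Mapping.keys m" by (auto simp: in_keys_iff)
    then have "i \<in> {1..n}" using mon unfolding monomials_def by blast
    \<comment> \<open>The powers of 2 are distinct, so this torus element distinguishes exponents at
      i, where m and m' differ.\<close>
    let ?t = "\<lambda>j. if j = i then 2 else 1 :: complex"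
    have t: "(\<Prod>j=1..n. ?t j ^ f j) = 2 ^ f i" for f
    proof -
      have "(\<Prod>j=1..n. ?t j ^ f j) = (\<Prod>j=1..n. if j = i then 2 ^ f j else 1)"
        by (rule prod.cong) auto
      then show ?thesis using \<open>i \<in> {1..n}\<close> by simp
    qed
    \<comment> \<open>Subtracting the eigenvalue at m' kills the monomial m' and multiplies the
      coefficient of m by a nonzero difference of powers of 2.\<close>
    define u where "u = sym_act n (torus_mat n ?t) v - sym_scale (2 ^ Poly_Mapping.lookup m' i) v"
    have T: "torus_mat n ?t \<in> GL n"
      using torus_mat_borel[of n ?t] by (auto simp: borel_minus_def)
    have u: "Poly_Mapping.lookup u k =
        (2 ^ Poly_Mapping.lookup k i - 2 ^ Poly_Mapping.lookup m' i) * Poly_Mapping.lookup v k" for k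
      unfolding u_def lookup_minus lookup_sym_act_torus[OF less.prems(2)] t lookup_sym_scale
      by (simp add: left_diff_distrib)
    have keys: "Poly_Mapping.keys u \<subseteq> Poly_Mapping.keys v - {m'}"
      by (auto simp: in_keys_iff u)
    show ?thesis
    proof (rule less.hyps)
      show "card (Poly_Mapping.keys u) < card (Poly_Mapping.keys v)"
        using keys m'(1) by (intro psubset_card_mono) auto
      show "u \<in> W" unfolding u_def
        by (intro sym.subspace_diff sym.subspace_scale sub act T less.prems(1))
      show "u \<in> sym_power n d" using keys less.prems(2) by (auto simp: sym_power_iff)
      have "(2::complex) ^ Poly_Mapping.lookup m i \<noteq> 2 ^ Poly_Mapping.lookup m' i"
      proof
        assume "(2::complex) ^ Poly_Mapping.lookup m i = 2 ^ Poly_Mapping.lookup m' i"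
        then have "complex_of_nat (2 ^ Poly_Mapping.lookup m i) = of_nat (2 ^ Poly_Mapping.lookup m' i)"
          by simp
        then have "(2::nat) ^ Poly_Mapping.lookup m i = 2 ^ Poly_Mapping.lookup m' i"
          by (simp only: of_nat_eq_iff)
        then show False using i by simp
      qed
      then show "m \<in> Poly_Mapping.keys u" using less.prems(3) by (simp add: in_keys_iff u)
    qed
  qed
qed

lemma single_in_sym_power: "m \<in> monomials n d \<Longrightarrow> Poly_Mapping.single m c \<in> sym_power n d"
  by (auto simp: sym_power_iff)

lemma irreducible_sym_power:
  assumes "n \<ge> 1"
  shows "irreducible_rep n sym_scale (sym_act n) (sym_power n d)"
  unfolding irreducible_rep_def
proof (intro conjI allI impI)
  show "subrep n sym_scale (sym_act n) (sym_power n d)"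
    by (simp add: subrep_def subspace_sym_power sym_act_in_sym_power)
  have n: "Poly_Mapping.single n d \<in> monomials n d" using assms by (intro monomials_single) auto
  have "(Poly_Mapping.single (Poly_Mapping.single n d) 1 :: sym_alg) \<noteq> 0"
    by (metis lookup_single_eq lookup_zero zero_neq_one)
  then show "sym_power n d \<noteq> {0}" using single_in_sym_power[OF n, of 1] by blast
  fix W assume W: "subrep n sym_scale (sym_act n) W \<and> W \<subseteq> sym_power n d"
  have sub: "sym.subspace W" and act: "\<And>g u. g \<in> GL n \<Longrightarrow> u \<in> W \<Longrightarrow> sym_act n g u \<in> W"
    and in_W: "\<And>v m. v \<in> W \<Longrightarrow> m \<in> Poly_Mapping.keys v \<Longrightarrow> Poly_Mapping.single m 1 \<in> W"
    using W subrep_monomial[of n W] by (auto simp: subrep_def)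
  show "W = {0} \<or> W = sym_power n d"
  proof (rule disjCI)
    assume "W \<noteq> sym_power n d"
    show "W = {0}"
    proof (rule ccontr)
      assume "W \<noteq> {0}"
      then obtain v where v: "v \<in> W" "v \<noteq> 0" using sym.subspace_0[OF sub] by blast
      then obtain m where m: "m \<in> Poly_Mapping.keys v" by fastforce
      have "v \<in> sym_power n d" using v(1) W by blast
      then have "m \<in> monomials n d" using m by (auto simp: sym_power_iff)
      have "sym_act n (lower_ones n) (Poly_Mapping.single m 1) \<in> W"
        using lower_ones_borel[of n] in_W[OF v(1) m] by (auto simp: borel_minus_def intro: act)
      then have "Poly_Mapping.single (Poly_Mapping.single n d) 1 \<in> W"
        by (rule in_W) (rule sym_act_lower_ones[OF \<open>m \<in> monomials n d\<close> assms])
      then have "sym_act n (upper_ones n) (Poly_Mapping.single (Poly_Mapping.single n d) 1) \<in> W"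
        by (rule act[OF upper_ones_GL])
      then have mon: "Poly_Mapping.single m 1 \<in> W" if "m \<in> monomials n d" for m
        using in_W sym_act_upper_ones[OF assms, of d] that by blast
      have "p \<in> W" if "p \<in> sym_power n d" for p
      proof -
        have "(\<Sum>m\<in>Poly_Mapping.keys p. sym_scale (Poly_Mapping.lookup p m) (Poly_Mapping.single m 1)) \<in> W"
          using that by (intro sym.subspace_sum[OF sub] sym.subspace_scale[OF sub] mon)
            (auto simp: sym_power_iff)
        then show ?thesis by (simp add: sum_monomials)
      qed
      then show False using W \<open>W \<noteq> sym_power n d\<close> by blast
    qed
  qed
qed

text \<open>Torus elements force every monomial of a highest weight vector to have exponent vector
  lambda, so the vector is a multiple of one monomial. It is also an eigenvector of
  \<open>lower_ones\<close>, whose image of it contains e_n^d, so that monomial is e_n^d.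
  Conversely, a lower triangular matrix maps e_n to a multiple of itself.\<close>

lemma is_V_sym_power_iff:
  assumes "n \<ge> 1" "lam \<in> cochars n"
  shows "is_V n sym_scale (sym_act n) lam (sym_power n d) \<longleftrightarrow> lam = (\<lambda>i. if i = n then int d else 0)"
proof
  assume "is_V n sym_scale (sym_act n) lam (sym_power n d)"
  then obtain v where v: "v \<in> sym_power n d" "v \<noteq> 0"
    and act: "\<And>b. b \<in> borel_minus n \<Longrightarrow> sym_act n b v = sym_scale (borel_character n lam b) v"
    by (auto simp: is_V_def)
  have lam: "lam i = int (Poly_Mapping.lookup m i)" if m: "m \<in> Poly_Mapping.keys v" for m i
  proof (cases "i \<in> {1..n}")
    case True
    let ?t = "\<lambda>j. if j = i then 2 else 1 :: complex"
    have "sym_act n (torus_mat n ?t) v = sym_scale (borel_character n lam (torus_mat n ?t)) v"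
      by (rule act[OF torus_mat_borel]) simp
    then have "Poly_Mapping.lookup (sym_act n (torus_mat n ?t) v) m =
        Poly_Mapping.lookup (sym_scale (borel_character n lam (torus_mat n ?t)) v) m"
      by (rule arg_cong)
    then have "(\<Prod>j=1..n. ?t j ^ Poly_Mapping.lookup m j) * Poly_Mapping.lookup v m =
      borel_character n lam (torus_mat n ?t) * Poly_Mapping.lookup v m"
      by (simp only: lookup_sym_act_torus[OF v(1)] lookup_sym_scale)
    then have "(\<Prod>j=1..n. ?t j ^ Poly_Mapping.lookup m j) = borel_character n lam (torus_mat n ?t)"
      using m by (simp add: in_keys_iff)
    also have "\<dots> = (\<Prod>j=1..n. if j = i then 2 powi lam i else 1)"
      unfolding borel_character_def by (rule prod.cong) (auto simp: torus_mat_def)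
    also have "(\<Prod>j=1..n. ?t j ^ Poly_Mapping.lookup m j) =
        (\<Prod>j=1..n. if j = i then 2 powi int (Poly_Mapping.lookup m i) else 1)"
      by (rule prod.cong) auto
    \<comment> \<open>Over the reals, strict monotonicity of the powers of 2 allows the exponents to
      be compared.\<close>
    finally have "complex_of_real (2 powi int (Poly_Mapping.lookup m i)) = complex_of_real (2 powi lam i)"
      using True by simp
    then have "(2::real) powi int (Poly_Mapping.lookup m i) = 2 powi lam i"
      by (simp only: of_real_eq_iff)
    then show ?thesis
      using power_int_strict_increasing[of _ _ "2::real"]
      by (metis less_irrefl linorder_neqE one_less_numeral_iff semiring_norm(76))
  next
    case False
    then have "lam i = 0" using assms(2) by (simp add: cochars_def)
    moreover have "i \<notin> Poly_Mapping.keys m" using False m v(1)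
      unfolding sym_power_iff monomials_def by blast
    ultimately show ?thesis by (simp add: in_keys_iff)
  qed
  obtain m where m: "m \<in> Poly_Mapping.keys v" using v(2) by fastforce
  have "m' = m" if "m' \<in> Poly_Mapping.keys v" for m'
    using lam[OF that] lam[OF m] by (intro poly_mapping_eqI) simp
  then have keys: "Poly_Mapping.keys v = {m}" using m by blast
  have "m \<in> monomials n d" using m v(1) by (auto simp: sym_power_iff)
  have "Poly_Mapping.lookup v m \<noteq> 0" using m by (simp add: in_keys_iff)
  with sym_act_lower_ones[OF \<open>m \<in> monomials n d\<close> assms(1)]
  have "Poly_Mapping.single n d \<in> Poly_Mapping.keys (sym_act n (lower_ones n) v)"
    by (simp add: sym_act_def keys in_keys_iff)
  also have "sym_act n (lower_ones n) v = sym_scale (borel_character n lam (lower_ones n)) v"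
    by (rule act) (rule lower_ones_borel)
  finally have "Poly_Mapping.single n d \<in> Poly_Mapping.keys v"
    using keys_sym_scale by blast
  then show "lam = (\<lambda>i. if i = n then int d else 0)"
    using lam by (auto simp: fun_eq_iff lookup_single when_def)
next
  assume lam: "lam = (\<lambda>i. if i = n then int d else 0)"
  let ?v = "Poly_Mapping.single (Poly_Mapping.single n d) 1 :: sym_alg"
  have "?v \<in> sym_power n d" using assms(1) by (intro single_in_sym_power monomials_single) auto
  moreover have "?v \<noteq> 0" by (metis lookup_single_eq lookup_zero zero_neq_one)
  moreover have "sym_act n b ?v = sym_scale (borel_character n lam b) ?v" if b: "b \<in> borel_minus n" for b
  proof -
    have "std_act n b n = (\<Sum>i=1..n. if i = n then
        Poly_Mapping.single (Poly_Mapping.single n 1) (b $$ (n - 1, n - 1)) else 0)"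
      unfolding std_act_eq
    proof (rule sum.cong)
      fix i assume i: "i \<in> {1..n}"
      then have "i = n \<or> i - 1 < n - 1 \<and> n - 1 < n" using assms(1) by auto
      then have "i = n \<or> b $$ (i - 1, n - 1) = 0"
        using b by (auto simp: borel_minus_def)
      then show "Poly_Mapping.single (Poly_Mapping.single i 1) (b $$ (i - 1, n - 1)) =
        (if i = n then Poly_Mapping.single (Poly_Mapping.single n 1) (b $$ (n - 1, n - 1)) else 0)"
        by auto
    qed simp
    then have std: "std_act n b n = Poly_Mapping.single (Poly_Mapping.single n 1) (b $$ (n - 1, n - 1))"
      using assms(1) by simp
    have "sym_act n b ?v = std_act n b n ^ d"
      unfolding sym_act_single by (cases "d = 0") simp_all
    also have "\<dots> = Poly_Mapping.single (Poly_Mapping.single n d) (b $$ (n - 1, n - 1) ^ d)"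
      unfolding std by (rule single_power)
    also have "b $$ (n - 1, n - 1) ^ d = borel_character n lam b"
    proof -
      have "borel_character n lam b = (\<Prod>i=1..n. if i = n then b $$ (n - 1, n - 1) ^ d else 1)"
        unfolding borel_character_def lam by (rule prod.cong) auto
      then show ?thesis using assms(1) by simp
    qed
    finally show ?thesis by simp
  qed
  ultimately show "is_V n sym_scale (sym_act n) lam (sym_power n d)"
    using irreducible_sym_power[OF assms(1)] unfolding is_V_def by blast
qed

text \<open>The only decomposition of an irreducible U is {U}: every summand is a nonzero
  subrepresentation of U, and U \<noteq> {0} requires a summand. So the description by THE is well
  defined.\<close>

lemma mult_V_irreducible:
  assumes "Modules.module smul" "irreducible_rep n smul act U"
  shows "mult_V n smul act U lam = (if is_V n smul act lam U then 1 else 0)"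
proof -
  interpret Modules.module smul by fact
  have zero: "0 \<in> W" if "irreducible_rep n smul act W" for W
    using that by (auto simp: irreducible_rep_def subrep_def intro: subspace_0)
  have "bij_betw (\<lambda>f. \<Sum>W\<in>{U}. f W) (\<Pi>\<^sub>E W\<in>{U}. W) U"
    by (rule bij_betwI[where g = "\<lambda>u. \<lambda>W\<in>{U}. u"]) (auto simp: PiE_def extensional_def fun_eq_iff)
  then have U: "irreducible_decomposition n smul act U {U}"
    using assms(2) by (auto simp: irreducible_decomposition_def)
  have uniq: "D = {U}" if "irreducible_decomposition n smul act U D" for D
  proof -
    have fin: "finite D" and irr: "\<And>W. W \<in> D \<Longrightarrow> irreducible_rep n smul act W"
      and bij: "bij_betw (\<lambda>f. \<Sum>W\<in>D. f W) (\<Pi>\<^sub>E W\<in>D. W) U"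
      using that by (auto simp: irreducible_decomposition_def)
    have "W = U" if W: "W \<in> D" for W
    proof -
      have "v \<in> U" if "v \<in> W" for v
      proof -
        \<comment> \<open>Extending v by 0 to the other summands exhibits v as a value of the sum
          map, hence as an element of U.\<close>
        let ?f = "\<lambda>W'\<in>D. if W' = W then v else 0"
        have "?f \<in> (\<Pi>\<^sub>E W\<in>D. W)" using that zero irr by auto
        then have "(\<Sum>W\<in>D. ?f W) \<in> U" by (rule bij_betw_apply[OF bij])
        then show ?thesis using W fin by simp
      qed
      then show ?thesis using irr[OF W] assms(2) by (auto simp: irreducible_rep_def)
    qed
    moreover have "D \<noteq> {}"
    proof
      assume "D = {}"
      then have "U = {0}" using bij_betw_imp_surj_on[OF bij] by simp
      then show False using assms(2) by (simp add: irreducible_rep_def)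
    qed
    ultimately show ?thesis by blast
  qed
  have "{W \<in> {U}. is_V n smul act lam W} = (if is_V n smul act lam U then {U} else {})" by auto
  then have card: "card {W \<in> {U}. is_V n smul act lam W} = (if is_V n smul act lam U then 1 else 0)"
    by simp
  show ?thesis
    unfolding mult_V_def
  proof (rule the_equality)
    show "\<exists>D. irreducible_decomposition n smul act U D \<and>
        (if is_V n smul act lam U then 1 else 0) = card {W \<in> D. is_V n smul act lam W}"
      using U card by (intro exI[of _ "{U}"]) simp
  next
    fix m assume "\<exists>D. irreducible_decomposition n smul act U D \<and> m = card {W \<in> D. is_V n smul act lam W}"
    then obtain D where "irreducible_decomposition n smul act U D"
      and m: "m = card {W \<in> D. is_V n smul act lam W}" by blast
    then have "D = {U}" by (intro uniq)
    then show "m = (if is_V n smul act lam U then 1 else 0)" using m card by simp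
  qed
qed

lemma mult_Sym_eq:
  assumes "n \<ge> 1" "lam \<in> cochars n"
  shows "mult_Sym n d lam = (if lam = (\<lambda>i. if i = n then int d else 0) then 1 else 0)"
  unfolding mult_Sym_def
  by (simp only: mult_V_irreducible[OF sym.module_axioms irreducible_sym_power[OF assms(1)]]
      is_V_sym_power_iff[OF assms])


section \<open>The coefficients \<open>c\<^sub>\<mu>\<close>\<close>

text \<open>Coordinate i meets only the simple roots (i - 1, i) and (i, i + 1), each as far as it
  exists.\<close>

lemma sum_simple_roots:
  "(\<Sum>\<alpha>\<in>simple_roots n. int (k \<alpha>) * (- coroot \<alpha> i)) =
    (if i \<in> {2..n} then int (k (i - 1, i)) else 0) - (if i \<in> {1..<n} then int (k (i, Suc i)) else 0)"
proof -
  have inj: "inj_on (\<lambda>j. (j, Suc j)) {1..<n}" by (auto simp: inj_on_def)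
  have "simple_roots n = (\<lambda>j. (j, Suc j)) ` {1..<n}"
    by (auto simp: simple_roots_def)
  then have "(\<Sum>\<alpha>\<in>simple_roots n. int (k \<alpha>) * (- coroot \<alpha> i)) =
    (\<Sum>j\<in>{1..<n}. int (k (j, Suc j)) * (eps (Suc j) i - eps j i))"
    by (simp only: sum.reindex[OF inj]) (simp add: coroot_def)
  also have "\<dots> = (\<Sum>j\<in>{1..<n}. if i = Suc j then int (k (j, Suc j)) else 0) -
      (\<Sum>j\<in>{1..<n}. if j = i then int (k (j, Suc j)) else 0)"
    unfolding sum_subtractf[symmetric] by (rule sum.cong) (auto simp: eps_def)
  also have "(\<Sum>j\<in>{1..<n}. if i = Suc j then int (k (j, Suc j)) else 0) =
      (if i \<in> {2..n} then int (k (i - 1, i)) else 0)"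
  proof (cases i)
    case (Suc i')
    then have "(\<Sum>j\<in>{1..<n}. if i = Suc j then int (k (j, Suc j)) else 0) =
      (\<Sum>j\<in>{1..<n}. if j = i' then int (k (j, Suc j)) else 0)"
      by (intro sum.cong) auto
    then show ?thesis using Suc by auto
  qed (auto intro!: sum.neutral)
  finally show ?thesis by simp
qed

lemma cochar_le_one_row:
  assumes "n \<ge> 1" "\<And>i. i \<notin> {1..n} \<Longrightarrow> m i = 0"
  shows "cochar_le n (int \<circ> m) (\<lambda>i. if i = n then int (\<Sum>i=1..n. m i) else 0)"
  unfolding cochar_le_def
\<comment> \<open>By telescoping, the simple root (i, i + 1) must occur m_1 + ... + m_i
  times.\<close>
proof (intro exI[of _ "\<lambda>\<alpha>. \<Sum>j=1..fst \<alpha>. m j"] allI)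
  fix i
  have split: "(\<Sum>j=1..i. m j) = (\<Sum>j=1..i - 1. m j) + m i" if "i \<ge> 1"
    using that by (cases i) auto
  show "(if i = n then int (\<Sum>i=1..n. m i) else 0) - (int \<circ> m) i =
    (\<Sum>\<alpha>\<in>simple_roots n. int (\<Sum>j=1..fst \<alpha>. m j) * - coroot \<alpha> i)"
  proof (cases "i \<in> {1..n}")
    case True
    then have "int (\<Sum>j=1..i. m j) = int (\<Sum>j=1..i - 1. m j) + int (m i)" using split by simp
    then show ?thesis unfolding sum_simple_roots using True
      by (cases "i = n"; cases "i = 1") auto
  next
    case False
    then show ?thesis unfolding sum_simple_roots using assms by auto
  qed
qed

text \<open>At coordinate 1 the relation says that mu_1 is the multiplicity of the root (1, 2), or d
  if n = 1. All other entries are at least mu_1.\<close>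

lemma nonneg_if_cochar_le_one_row:
  assumes "n \<ge> 1" "\<mu> \<in> cochars_minus n" "cochar_le n \<mu> (\<lambda>i. if i = n then int d else 0)"
  shows "\<mu> i \<ge> 0"
proof -
  obtain k where k: "(if i = n then int d else 0) - \<mu> i = (\<Sum>\<alpha>\<in>simple_roots n. int (k \<alpha>) * (- coroot \<alpha> i))" for i
    using assms(3) unfolding cochar_le_def by blast
  have "\<mu> 1 \<ge> 0" using k[of 1] assms(1) unfolding sum_simple_roots by (auto split: if_splits)
  then show ?thesis using assms(2) unfolding cochars_minus_def cochars_def
    by (cases "i \<in> {1..n}") (force, simp)
qed

lemma one_row_in_cochars_minus:
  "n \<ge> 1 \<Longrightarrow> (\<lambda>i. if i = n then int d else 0) \<in> cochars_minus n"
  by (auto simp: cochars_minus_def cochars_def)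

lemma c_coeff_eq_sum_one_row:
  assumes "n \<ge> 1"
  defines "one_row \<equiv> \<lambda>d i. if i = n then int d else 0"
  shows "c_coeff n \<mu> = (if cochar_le n \<mu> (one_row (nat (cochar_det n \<mu>)))
    then poly (map_poly of_int (kostka_K n (one_row (nat (cochar_det n \<mu>))) \<mu>)) (qpow (-1)) else 0)"
proof -
  let ?d = "nat (cochar_det n \<mu>)"
  have mult: "mult_Sym n ?d lam = (if lam = one_row ?d then 1 else 0)" if "lam \<in> cochars_minus n" for lam
    using mult_Sym_eq[OF assms(1), of lam ?d] that by (simp add: cochars_minus_def one_row_def)
  have row: "one_row ?d \<in> cochars_minus n"
    using one_row_in_cochars_minus[OF assms(1)] by (simp add: one_row_def)
  have "{lam \<in> cochars_minus n. cochar_le n \<mu> lam \<and> mult_Sym n ?d lam \<noteq> 0} =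
    (if cochar_le n \<mu> (one_row ?d) then {one_row ?d} else {})"
    using row by (auto simp: mult split: if_splits)
  then show ?thesis by (simp add: c_coeff_def mult[OF row] del: mult_eq_0_iff)
qed

lemma qpow_power: "qpow a ^ k = qpow (int k * a)"
  by (induction k) (simp_all add: qpow_def mult_single algebra_simps)

lemma invert_q_qpow: "invert_q (qpow a) = qpow (- a)"
  using map_key_single[of uminus "- a" "1 :: int"] by (simp add: invert_q_def qpow_def)

lemma invert_q_0: "invert_q 0 = 0"
  by (simp add: invert_q_def)

text \<open>c_mu evaluates K at the inverse of q, so \<open>invert_q\<close> restores the monomial
  found in \<open>kostka_K_one_row\<close>.\<close>

lemma invert_q_c_coeff:
  assumes "n \<ge> 1" "\<And>i. i \<notin> {1..n} \<Longrightarrow> m i = 0"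
  shows "invert_q (c_coeff n (int \<circ> m)) = qpow (int (\<Sum>i=1..n. (n - i) * m i))"
proof -
  have det: "nat (cochar_det n (int \<circ> m)) = (\<Sum>i=1..n. m i)"
    by (simp add: cochar_det_def flip: of_nat_sum)
  have "c_coeff n (int \<circ> m) = qpow (- int (\<Sum>i=1..n. (n - i) * m i))"
    unfolding c_coeff_eq_sum_one_row[OF assms(1)] det
    using cochar_le_one_row[OF assms] kostka_K_one_row[OF assms]
    by (simp add: map_poly_monom poly_monom qpow_power)
  then show ?thesis by (simp add: invert_q_qpow)
qed

lemma c_coeff_eq_0:
  assumes "n \<ge> 1" "\<mu> \<in> cochars_minus n" "\<mu> i < 0"
  shows "c_coeff n \<mu> = 0"
  unfolding c_coeff_eq_sum_one_row[OF assms(1)]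
  using nonneg_if_cochar_le_one_row[OF assms(1,2), of _ i] assms(3) by force


section \<open>Conjugate partitions\<close>

text \<open>These are the mu of determinant k in X_ominus whose coefficient c_mu is nonzero.\<close>

definition increasing_comps :: "nat \<Rightarrow> nat \<Rightarrow> (nat \<Rightarrow> nat) set" where
  "increasing_comps n k = {m \<in> weighted_comps (\<lambda>_. 1) n k. \<forall>i j. 1 \<le> i \<and> i \<le> j \<and> j \<le> n \<longrightarrow> m i \<le> m j}"

text \<open>If \<open>a\<^sub>i\<close> is the number of columns of length \<open>i\<close>, then \<open>tail_sums n a\<close> lists the rows in
  increasing order: it is the coordinate vector of \<open>\<Sum> a\<^sub>i \<lambda>\<^sub>i\<close>.\<close>

definition tail_sums :: "nat \<Rightarrow> (nat \<Rightarrow> nat) \<Rightarrow> nat \<Rightarrow> nat" where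
  "tail_sums n a = (\<lambda>j. if j \<in> {1..n} then \<Sum>i=Suc n - j..n. a i else 0)"

text \<open>Inverse to \<open>tail_sums\<close> on increasing m, where the natural number
  subtraction is exact. For i = n it subtracts m 0, which is 0 by the support condition.\<close>

definition differences :: "nat \<Rightarrow> (nat \<Rightarrow> nat) \<Rightarrow> nat \<Rightarrow> nat" where
  "differences n m = (\<lambda>i. if i \<in> {1..n} then m (Suc n - i) - m (n - i) else 0)"

text \<open>Both sides sum over the pairs with i + j > n, by rows or by columns. Taking f = 1 gives
  the degree, and f j = n - j gives the exponent of q.\<close>

lemma sum_mult_tail_sums:
  "(\<Sum>j=1..n. f j * tail_sums n a j) = (\<Sum>i=1..n. a i * (\<Sum>j=Suc n - i..n. f j))"
proof -
  have "(\<Sum>j=1..n. f j * tail_sums n a j) =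
      (\<Sum>j=1..n. \<Sum>i=1..n. if Suc n \<le> i + j then f j * a i else 0)"
  proof (rule sum.cong)
    fix j assume "j \<in> {1..n}"
    then have "f j * tail_sums n a j = (\<Sum>i=Suc n - j..n. f j * a i)"
      by (simp add: tail_sums_def sum_distrib_left)
    also have "\<dots> = (\<Sum>i=1..n. if Suc n \<le> i + j then f j * a i else 0)"
      by (rule sum.mono_neutral_cong_left) (use \<open>j \<in> _\<close> in auto)
    finally show "f j * tail_sums n a j = (\<Sum>i=1..n. if Suc n \<le> i + j then f j * a i else 0)" .
  qed simp
  also have "\<dots> = (\<Sum>i=1..n. \<Sum>j=1..n. if Suc n \<le> i + j then f j * a i else 0)"
    by (rule sum.swap)
  also have "\<dots> = (\<Sum>i=1..n. a i * (\<Sum>j=Suc n - i..n. f j))"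
  proof (rule sum.cong)
    fix i assume "i \<in> {1..n}"
    show "(\<Sum>j=1..n. if Suc n \<le> i + j then f j * a i else 0) = a i * (\<Sum>j=Suc n - i..n. f j)"
      unfolding sum_distrib_left
      by (rule sum.mono_neutral_cong_right) (use \<open>i \<in> _\<close> in auto)
  qed simp
  finally show ?thesis .
qed

text \<open>The exponent of q belonging to lambda_i: its unit entries sit at the last i places,
  where n - j runs through i - 1, ..., 0.\<close>

lemma sum_tail_triangular: "i \<le> n \<Longrightarrow> (\<Sum>j=Suc n - i..n. n - j) = i * (i - 1) div 2"
proof (induction i)
  case (Suc i)
  have "(\<Sum>j=Suc n - Suc i..n. n - j) = i + (\<Sum>j=Suc n - i..n. n - j)"
    using Suc.prems by (subst sum.atLeast_Suc_atMost) (auto simp: Suc_diff_le)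
  also have "\<dots> = Suc i * (Suc i - 1) div 2"
    using Suc by (cases i) (auto simp: algebra_simps)
  finally show ?case .
qed simp

lemma tail_sums_differences:
  assumes "m \<in> increasing_comps n k"
  shows "tail_sums n (differences n m) = m"
proof
  fix j
  have m: "m i = 0" if "i \<notin> {1..n}" for i
    using assms that by (simp add: increasing_comps_def weighted_comps_def)
  have mono: "m i \<le> m (Suc i)" if "i < n" for i
    using assms that m[of 0] by (cases "i = 0") (auto simp: increasing_comps_def)
  have "(\<Sum>i=Suc n - j..n. differences n m i) = m j" if "j \<le> n"
    using that
  proof (induction j)
    case 0
    then show ?case using m[of 0] by simp
  next
    case (Suc j)
    have "(\<Sum>i=Suc n - Suc j..n. differences n m i) =
        differences n m (n - j) + (\<Sum>i=Suc n - j..n. differences n m i)"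
      using Suc.prems by (subst sum.atLeast_Suc_atMost) (auto simp: Suc_diff_le)
    also have "differences n m (n - j) = m (Suc j) - m j"
      using Suc.prems by (simp add: differences_def Suc_diff_le)
    finally show ?case using Suc mono[of j] by simp
  qed
  then show "tail_sums n (differences n m) j = m j"
    using m[of j] by (auto simp: tail_sums_def)
qed

lemma differences_tail_sums:
  assumes "a \<in> weighted_comps d n k"
  shows "differences n (tail_sums n a) = a"
proof
  fix i
  show "differences n (tail_sums n a) i = a i"
  proof (cases "i \<in> {1..n}")
    case True
    then have "tail_sums n a (Suc n - i) = a i + tail_sums n a (n - i)"
      by (cases "i = n") (auto simp: tail_sums_def Suc_diff_le sum.atLeast_Suc_atMost[of i n])
    then show ?thesis using True by (simp add: differences_def)
  next
    case False
    then show ?thesis using assms by (auto simp: differences_def weighted_comps_def)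
  qed
qed

lemma sum_tail_sums: "(\<Sum>j=1..n. tail_sums n a j) = (\<Sum>i=1..n. i * a i)"
proof -
  have "(\<Sum>j=1..n. tail_sums n a j) = (\<Sum>i=1..n. a i * (\<Sum>j=Suc n - i..n. 1))"
    using sum_mult_tail_sums[of "\<lambda>_. 1" n a] by simp
  also have "\<dots> = (\<Sum>i=1..n. i * a i)" by (rule sum.cong) auto
  finally show ?thesis .
qed

lemma tail_sums_increasing_comps:
  "a \<in> weighted_comps (\<lambda>i. i) n k \<Longrightarrow> tail_sums n a \<in> increasing_comps n k"
proof -
  assume a: "a \<in> weighted_comps (\<lambda>i. i) n k"
  have "tail_sums n a i \<le> tail_sums n a j" if "1 \<le> i" "i \<le> j" "j \<le> n" for i j
    using that by (auto simp: tail_sums_def intro!: sum_mono2)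
  moreover have "(\<Sum>j=1..n. tail_sums n a j) = k"
    using a unfolding sum_tail_sums by (simp add: weighted_comps_def)
  ultimately show ?thesis
    by (auto simp: increasing_comps_def weighted_comps_def) (auto simp: tail_sums_def)
qed

lemma differences_weighted_comps:
  assumes "m \<in> increasing_comps n k"
  shows "differences n m \<in> weighted_comps (\<lambda>i. i) n k"
proof -
  have "(\<Sum>i=1..n. i * differences n m i) = (\<Sum>j=1..n. m j)"
    using sum_tail_sums[of n "differences n m"] by (simp only: tail_sums_differences[OF assms])
  then show ?thesis using assms
    by (auto simp: increasing_comps_def weighted_comps_def differences_def)
qed

section \<open>Coefficients of the product and comparison with the sum\<close>

lemma prod_fund_cochar:
  "(\<Prod>i=1..n. Poly_Mapping.single (fund_cochar n i) (qpow (int (i * (i - 1) div 2))) ^ a i) =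
    Poly_Mapping.single (int \<circ> tail_sums n a) (qpow (int (\<Sum>j=1..n. (n - j) * tail_sums n a j)))"
proof -
  have pow: "Poly_Mapping.single \<nu> (qpow b) ^ k =
      Poly_Mapping.single (\<lambda>i. int k * \<nu> i) (qpow (int k * b))" for \<nu> :: cochar and b k
  proof (induction k)
    case 0
    have "(\<lambda>i::nat. 0::int) = 0" by auto
    then show ?case by (simp add: qpow_def)
  next
    case (Suc k)
    have \<nu>: "\<nu> + (\<lambda>i. int k * \<nu> i) = (\<lambda>i. int (Suc k) * \<nu> i)" by (auto simp: algebra_simps)
    have "qpow b * qpow (int k * b) = qpow (int (Suc k) * b)"
      by (simp add: qpow_def mult_single algebra_simps)
    then show ?case by (simp only: power_Suc Suc mult_single \<nu>)
  qed
  have prod: "(\<Prod>i\<in>S. Poly_Mapping.single (\<nu> i) (qpow (b i))) =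
      Poly_Mapping.single (sum \<nu> S) (qpow (sum b S))"
    if "finite S" for S :: "nat set" and \<nu> :: "nat \<Rightarrow> cochar" and b
    using that
  proof (induction S rule: finite_induct)
    case empty
    then show ?case by (simp only: prod.empty sum.empty qpow_def single_one)
  next
    case (insert x S)
    then show ?case
      unfolding prod.insert[OF insert(1,2)] sum.insert[OF insert(1,2)] insert(3)
      by (simp only: mult_single qpow_def mult_1)
  qed
  have fund: "fund_cochar n i j = (if Suc n \<le> i + j \<and> j \<le> n then 1 else 0)" if "i \<in> {1..n}" for i j
  proof -
    have "fund_cochar n i j = (\<Sum>j'=n-i+1..n. if j' = j then 1 else 0)"
      unfolding fund_cochar_def sum_fun_apply by (rule sum.cong) (auto simp: eps_def)
    then show ?thesis using that by auto
  qed
  have "(\<Sum>i=1..n. (\<lambda>j. int (a i) * fund_cochar n i j)) = int \<circ> tail_sums n a"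
  proof
    fix j
    have "(\<Sum>i=1..n. (\<lambda>j. int (a i) * fund_cochar n i j)) j =
      (\<Sum>i=1..n. if Suc n \<le> i + j \<and> j \<le> n then int (a i) else 0)"
      unfolding sum_fun_apply by (rule sum.cong) (auto simp: fund)
    also have "\<dots> = int (tail_sums n a j)"
    proof (cases "j \<in> {1..n}")
      case True
      then have "(\<Sum>i=1..n. if Suc n \<le> i + j \<and> j \<le> n then int (a i) else 0) =
          (\<Sum>i=Suc n - j..n. int (a i))"
        by (intro sum.mono_neutral_cong_right) auto
      then show ?thesis using True by (simp add: tail_sums_def)
    qed (auto simp: tail_sums_def intro!: sum.neutral)
    finally show "(\<Sum>i=1..n. (\<lambda>j. int (a i) * fund_cochar n i j)) j = (int \<circ> tail_sums n a) j" by simp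
  qed
  moreover have "(\<Sum>i=1..n. int (a i) * int (i * (i - 1) div 2)) =
      int (\<Sum>j=1..n. (n - j) * tail_sums n a j)"
    unfolding sum_mult_tail_sums of_nat_sum
    by (rule sum.cong) (auto simp: sum_tail_triangular simp flip: of_nat_mult)
  ultimately show ?thesis by (simp only: pow prod finite_atLeastAtMost)
qed

lemma fps_nth_prod_fund_cochar:
  "fps_nth (\<Prod>i=1..n. fps_right_inverse
      (1 - fps_const (Poly_Mapping.single (fund_cochar n i) (qpow (int (i * (i - 1) div 2)))) * fps_X ^ i) 1) k =
    (\<Sum>m\<in>increasing_comps n k. Poly_Mapping.single (int \<circ> m) (qpow (int (\<Sum>j=1..n. (n - j) * m j))))"
proof -
  have "fps_nth (\<Prod>i=1..n. fps_right_inverse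
      (1 - fps_const (Poly_Mapping.single (fund_cochar n i) (qpow (int (i * (i - 1) div 2)))) * fps_X ^ i) 1) k =
    (\<Sum>a\<in>weighted_comps (\<lambda>i. i) n k. Poly_Mapping.single (int \<circ> tail_sums n a)
       (qpow (int (\<Sum>j=1..n. (n - j) * tail_sums n a j))))"
    by (subst fps_nth_prod_geometric) (simp, intro sum.cong refl prod_fund_cochar)
  also have "\<dots> = (\<Sum>m\<in>increasing_comps n k. Poly_Mapping.single (int \<circ> m)
      (qpow (int (\<Sum>j=1..n. (n - j) * m j))))"
    by (rule sum.reindex_bij_witness[where i = "differences n" and j = "tail_sums n"])
      (auto simp only: differences_tail_sums tail_sums_differences
         tail_sums_increasing_comps differences_weighted_comps)
  finally show ?thesis .
qed

lemma increasing_comps_cochars_ominus: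
  assumes "m \<in> increasing_comps n k"
  shows "int \<circ> m \<in> cochars_ominus n" "nat (cochar_det n (int \<circ> m)) = k"
proof -
  have "cochar_det n (int \<circ> m) = int k"
    using assms by (auto simp: cochar_det_def increasing_comps_def weighted_comps_def simp flip: of_nat_sum)
  then show "int \<circ> m \<in> cochars_ominus n" "nat (cochar_det n (int \<circ> m)) = k"
    using assms
    by (auto simp: cochars_ominus_def cochars_minus_def cochars_def increasing_comps_def weighted_comps_def)
qed

lemma nonneg_cochars_minus_obtain:
  assumes "\<mu> \<in> cochars_minus n" "\<And>i. \<mu> i \<ge> 0"
  obtains m where "m \<in> increasing_comps n (nat (cochar_det n \<mu>))" "\<mu> = int \<circ> m"
proof
  show \<mu>: "\<mu> = int \<circ> (nat \<circ> \<mu>)" using assms(2) by (auto simp: fun_eq_iff)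
  have "cochar_det n \<mu> = int (\<Sum>i=1..n. nat (\<mu> i))"
    using assms(2) by (simp add: cochar_det_def)
  then have det: "nat (cochar_det n \<mu>) = (\<Sum>i=1..n. nat (\<mu> i))" by (simp only: nat_int)
  show "nat \<circ> \<mu> \<in> increasing_comps n (nat (cochar_det n \<mu>))"
    unfolding det using assms by (auto simp: increasing_comps_def weighted_comps_def cochars_minus_def cochars_def nat_mono)
qed

theorem theorem6p1p4:
  fixes n :: nat
  assumes "n \<ge> 1"
  shows "((\<lambda>\<mu>. fps_const (Poly_Mapping.single \<mu> (invert_q (c_coeff n \<mu>))) * fps_X ^ nat (cochar_det n \<mu>))
           has_sum
           (\<Prod>i=1..n. fps_right_inverse
              (1 - fps_const (Poly_Mapping.single (fund_cochar n i) (qpow (int (i * (i - 1) div 2)))) * fps_X ^ i) 1))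
         (cochars_ominus n)"
  \<comment> \<open>Convergence of power series means that each coefficient is eventually constant.
    For X^k it suffices that a finite Y contains the finite set \<open>?X\<close>.\<close>
  unfolding has_sum_def tendsto_fps_iff
proof
  fix k
  let ?f = "\<lambda>\<mu>. fps_const (Poly_Mapping.single \<mu> (invert_q (c_coeff n \<mu>))) * fps_X ^ nat (cochar_det n \<mu>)"
  let ?X = "(\<lambda>m. int \<circ> m) ` increasing_comps n k"
  have fin: "finite ?X"
    using finite_weighted_comps[of n "\<lambda>_. 1" k] by (auto simp: increasing_comps_def)
  have inj: "inj_on (\<lambda>m. int \<circ> m) (increasing_comps n k)"
    by (auto simp: inj_on_def fun_eq_iff)
  have coeff: "fps_nth (?f \<mu>) k =
      (if nat (cochar_det n \<mu>) = k then Poly_Mapping.single \<mu> (invert_q (c_coeff n \<mu>)) else 0)" for \<mu>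
    by (simp add: fps_X_power_nth)
  \<comment> \<open>For n \<ge> 2 infinitely many mu have determinant k, but those outside
    \<open>?X\<close> have a negative entry, and there c_mu vanishes.\<close>
  have zero: "fps_nth (?f \<mu>) k = 0" if "\<mu> \<in> cochars_ominus n - ?X" for \<mu>
  proof (cases "nat (cochar_det n \<mu>) = k")
    case True
    have \<mu>: "\<mu> \<in> cochars_minus n" using that by (simp add: cochars_ominus_def)
    have "\<exists>i. \<mu> i < 0"
    proof (rule ccontr)
      assume "\<not> ?thesis"
      then have "\<And>i. \<mu> i \<ge> 0" by (simp add: not_less)
      then show False using nonneg_cochars_minus_obtain[OF \<mu>] that True by blast
    qed
    then show ?thesis using c_coeff_eq_0[OF assms \<mu>] by (auto simp: coeff invert_q_0)
  qed (simp add: coeff)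
  have "fps_nth (sum ?f Y) k = (\<Sum>m\<in>increasing_comps n k.
      Poly_Mapping.single (int \<circ> m) (qpow (int (\<Sum>j=1..n. (n - j) * m j))))"
    if "finite Y" "?X \<subseteq> Y" "Y \<subseteq> cochars_ominus n" for Y
  proof -
    have "fps_nth (sum ?f Y) k = (\<Sum>\<mu>\<in>Y. fps_nth (?f \<mu>) k)" by (rule fps_sum_nth)
    also have "\<dots> = (\<Sum>\<mu>\<in>?X. fps_nth (?f \<mu>) k)"
      by (rule sum.mono_neutral_right) (use that zero in blast)+
    also have "\<dots> = (\<Sum>m\<in>increasing_comps n k. fps_nth (?f (int \<circ> m)) k)"
      by (subst sum.reindex[OF inj]) (simp only: o_def)
    also have "\<dots> = (\<Sum>m\<in>increasing_comps n k.
        Poly_Mapping.single (int \<circ> m) (qpow (int (\<Sum>j=1..n. (n - j) * m j))))"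
    proof (rule sum.cong)
      fix m assume m: "m \<in> increasing_comps n k"
      then have "m i = 0" if "i \<notin> {1..n}" for i
        using that by (simp add: increasing_comps_def weighted_comps_def)
      then have "invert_q (c_coeff n (int \<circ> m)) = qpow (int (\<Sum>j=1..n. (n - j) * m j))"
        by (rule invert_q_c_coeff[OF assms])
      then show "fps_nth (?f (int \<circ> m)) k =
          Poly_Mapping.single (int \<circ> m) (qpow (int (\<Sum>j=1..n. (n - j) * m j)))"
        unfolding coeff by (simp only: increasing_comps_cochars_ominus(2)[OF m] if_True simp_thms)
    qed simp
    finally show ?thesis .
  qed
  then show "\<forall>\<^sub>F Y in finite_subsets_at_top (cochars_ominus n).
      fps_nth (sum ?f Y) k = fps_nth (\<Prod>i=1..n. fps_right_inverse
        (1 - fps_const (Poly_Mapping.single (fund_cochar n i) (qpow (int (i * (i - 1) div 2)))) * fps_X ^ i) 1) k"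
    unfolding eventually_finite_subsets_at_top fps_nth_prod_fund_cochar
    using fin increasing_comps_cochars_ominus(1)
    by (intro exI[of _ ?X]) blast
qed

end
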